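(* Over $\mathsf{RCA}_0$, the following are pairwise equivalent: (1) $\mathsf{B}\boldsymbol\Sigma^0_2$; (2) $\omega$ is linearizable; (3) $\omega^*$ is linearizable; (4) $\zeta$ is linearizable.
   Context: $\mathsf{RCA}_0$ is the usual base system of reverse mathematics, a theory in the language of second-order arithmetic: the axioms of discretely ordered semirings for $\mathbb{N}$, induction for $\Sigma^0_1$ formulas, and comprehension for $\Delta^0_1$ predicates (formulas may contain number and set parameters). $\mathsf{B}\boldsymbol\Sigma^0_2$ is the scheme $$(\forall i<n)(\exists m)\,\varphi(i,n,m)\implies(\exists k)(\forall i<n)(\exists m<k)\,\varphi(i,n,m),$$ where $\varphi$ is any $\Sigma^0_2$ formula (possibly with parameters), for every $n\in\mathbb{N}$. The following definitions are made in $\mathsf{RCA}_0$. A (countable) partial order is a set $P\subseteq\mathbb{N}$ with a set coding a partial order relation $\leq_P$ on $P$. A set $X$ is finite if $(\exists m)(\forall x\in X)(x<m)$. The partial order $P$ is: - $\omega$-like if every element of $P$ has finitely many predecessors; - $\omega^*$-like if every element of $P$ has finitely many successors; - $\zeta$-like if for every pair of elements $x,y\in P$ there exist only finitely many $z\in P$ with $x<_P z<_P y$. The predecessors of $x$ are the $y$ with $y<_P x$, and the successors of $x$ are the $y$ with $x<_P y$. A linear extension of $P$ is a linear order on the same set $P$ whose relation contains $\leq_P$. For $\tau\in\{\omega,\omega^*,\zeta\}$, "$\tau$ is linearizable" is the statement that every $\tau$-like partial order has a linear extension which is also $\tau$-like. *)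

theory Defs
  imports Main
begin

section \<open>The language of second-order arithmetic\<close>

text \<open>
  Number variables and set variables are both named by natural numbers and live in separate
  name spaces. Equality is primitive for numbers only.
\<close>

datatype tm =
    Var nat
  | Zero  ("\<^bold>0")
  | One  ("\<^bold>1")
  | Plus tm tm  (infixl "\<^bold>+" 65)
  | Times tm tm  (infixl "\<^bold>*" 70)

datatype fm =
    Equal tm tm  (infix "\<^bold>=" 50)
  | Less tm tm  (infix "\<^bold><" 50)
  | Mem tm nat  (infix "\<^bold>\<in>" 50)
  | Neg fm  ("\<^bold>\<not> _" [40] 40)
  | And fm fm  (infixr "\<^bold>\<and>" 35)
  | Or fm fm  (infixr "\<^bold>\<or>" 30)
  | Imp fm fm  (infixr "\<^bold>\<longrightarrow>" 25)
  | Forall nat fm  ("(\<^bold>\<forall> _./ _)" [1000, 10] 10)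
  | Exists nat fm  ("(\<^bold>\<exists> _./ _)" [1000, 10] 10)
  | ForallS nat fm  ("(\<^bold>\<forall>\<^sub>S _./ _)" [1000, 10] 10)
  | ExistsS nat fm  ("(\<^bold>\<exists>\<^sub>S _./ _)" [1000, 10] 10)

abbreviation Iff :: "fm \<Rightarrow> fm \<Rightarrow> fm"  (infixr "\<^bold>\<longleftrightarrow>" 25)
  where "\<phi> \<^bold>\<longleftrightarrow> \<psi> \<equiv> (\<phi> \<^bold>\<longrightarrow> \<psi>) \<^bold>\<and> (\<psi> \<^bold>\<longrightarrow> \<phi>)"

abbreviation ForallLess :: "nat \<Rightarrow> tm \<Rightarrow> fm \<Rightarrow> fm"  ("(\<^bold>\<forall> _ \<^bold>< _./ _)" [1000, 51, 10] 10)
  where "\<^bold>\<forall> x \<^bold>< t. \<phi> \<equiv> \<^bold>\<forall> x. (Var x \<^bold>< t \<^bold>\<longrightarrow> \<phi>)"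

abbreviation ExistsLess :: "nat \<Rightarrow> tm \<Rightarrow> fm \<Rightarrow> fm"  ("(\<^bold>\<exists> _ \<^bold>< _./ _)" [1000, 51, 10] 10)
  where "\<^bold>\<exists> x \<^bold>< t. \<phi> \<equiv> \<^bold>\<exists> x. (Var x \<^bold>< t \<^bold>\<and> \<phi>)"

fun vars_tm :: "tm \<Rightarrow> nat set" where
  "vars_tm (Var x) = {x}"
| "vars_tm \<^bold>0 = {}"
| "vars_tm \<^bold>1 = {}"
| "vars_tm (s \<^bold>+ t) = vars_tm s \<union> vars_tm t"
| "vars_tm (s \<^bold>* t) = vars_tm s \<union> vars_tm t"

text \<open>Free number variables and free set variables of a formula.\<close>

fun fvn :: "fm \<Rightarrow> nat set" where
  "fvn (s \<^bold>= t) = vars_tm s \<union> vars_tm t"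
| "fvn (s \<^bold>< t) = vars_tm s \<union> vars_tm t"
| "fvn (t \<^bold>\<in> X) = vars_tm t"
| "fvn (\<^bold>\<not> \<phi>) = fvn \<phi>"
| "fvn (\<phi> \<^bold>\<and> \<psi>) = fvn \<phi> \<union> fvn \<psi>"
| "fvn (\<phi> \<^bold>\<or> \<psi>) = fvn \<phi> \<union> fvn \<psi>"
| "fvn (\<phi> \<^bold>\<longrightarrow> \<psi>) = fvn \<phi> \<union> fvn \<psi>"
| "fvn (\<^bold>\<forall> x. \<phi>) = fvn \<phi> - {x}"
| "fvn (\<^bold>\<exists> x. \<phi>) = fvn \<phi> - {x}"
| "fvn (\<^bold>\<forall>\<^sub>S X. \<phi>) = fvn \<phi>"
| "fvn (\<^bold>\<exists>\<^sub>S X. \<phi>) = fvn \<phi>"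

fun fvs :: "fm \<Rightarrow> nat set" where
  "fvs (s \<^bold>= t) = {}"
| "fvs (s \<^bold>< t) = {}"
| "fvs (t \<^bold>\<in> X) = {X}"
| "fvs (\<^bold>\<not> \<phi>) = fvs \<phi>"
| "fvs (\<phi> \<^bold>\<and> \<psi>) = fvs \<phi> \<union> fvs \<psi>"
| "fvs (\<phi> \<^bold>\<or> \<psi>) = fvs \<phi> \<union> fvs \<psi>"
| "fvs (\<phi> \<^bold>\<longrightarrow> \<psi>) = fvs \<phi> \<union> fvs \<psi>"
| "fvs (\<^bold>\<forall> x. \<phi>) = fvs \<phi>"
| "fvs (\<^bold>\<exists> x. \<phi>) = fvs \<phi>"
| "fvs (\<^bold>\<forall>\<^sub>S X. \<phi>) = fvs \<phi> - {X}"
| "fvs (\<^bold>\<exists>\<^sub>S X. \<phi>) = fvs \<phi> - {X}"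

fun subst_tm :: "nat \<Rightarrow> tm \<Rightarrow> tm \<Rightarrow> tm" where
  "subst_tm x u (Var y) = (if y = x then u else Var y)"
| "subst_tm x u \<^bold>0 = \<^bold>0"
| "subst_tm x u \<^bold>1 = \<^bold>1"
| "subst_tm x u (s \<^bold>+ t) = subst_tm x u s \<^bold>+ subst_tm x u t"
| "subst_tm x u (s \<^bold>* t) = subst_tm x u s \<^bold>* subst_tm x u t"

text \<open>
  Substitution of the term \<open>u\<close> for the free occurrences of \<open>x\<close>. Bound variables are not renamed,
  so in general a variable of \<open>u\<close> may be captured. No capture can occur if \<open>u\<close> has no variable
  other than \<open>x\<close>, because substitution stops at quantifiers that bind \<open>x\<close>; only the cases
  \<open>u = \<^bold>0\<close> and \<open>u = Var x \<^bold>+ \<^bold>1\<close> are used below.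
\<close>

fun subst_fm :: "nat \<Rightarrow> tm \<Rightarrow> fm \<Rightarrow> fm" where
  "subst_fm x u (s \<^bold>= t) = (subst_tm x u s \<^bold>= subst_tm x u t)"
| "subst_fm x u (s \<^bold>< t) = (subst_tm x u s \<^bold>< subst_tm x u t)"
| "subst_fm x u (t \<^bold>\<in> X) = (subst_tm x u t \<^bold>\<in> X)"
| "subst_fm x u (\<^bold>\<not> \<phi>) = (\<^bold>\<not> subst_fm x u \<phi>)"
| "subst_fm x u (\<phi> \<^bold>\<and> \<psi>) = (subst_fm x u \<phi> \<^bold>\<and> subst_fm x u \<psi>)"
| "subst_fm x u (\<phi> \<^bold>\<or> \<psi>) = (subst_fm x u \<phi> \<^bold>\<or> subst_fm x u \<psi>)"
| "subst_fm x u (\<phi> \<^bold>\<longrightarrow> \<psi>) = (subst_fm x u \<phi> \<^bold>\<longrightarrow> subst_fm x u \<psi>)"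
| "subst_fm x u (\<^bold>\<forall> y. \<phi>) = (if y = x then \<^bold>\<forall> y. \<phi> else \<^bold>\<forall> y. subst_fm x u \<phi>)"
| "subst_fm x u (\<^bold>\<exists> y. \<phi>) = (if y = x then \<^bold>\<exists> y. \<phi> else \<^bold>\<exists> y. subst_fm x u \<phi>)"
| "subst_fm x u (\<^bold>\<forall>\<^sub>S X. \<phi>) = (\<^bold>\<forall>\<^sub>S X. subst_fm x u \<phi>)"
| "subst_fm x u (\<^bold>\<exists>\<^sub>S X. \<phi>) = (\<^bold>\<exists>\<^sub>S X. subst_fm x u \<phi>)"


section \<open>Arithmetical hierarchy\<close>

inductive bounded_fm :: "fm \<Rightarrow> bool" where
  "bounded_fm (s \<^bold>= t)"
| "bounded_fm (s \<^bold>< t)"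
| "bounded_fm (t \<^bold>\<in> X)"
| "bounded_fm \<phi> \<Longrightarrow> bounded_fm (\<^bold>\<not> \<phi>)"
| "bounded_fm \<phi> \<Longrightarrow> bounded_fm \<psi> \<Longrightarrow> bounded_fm (\<phi> \<^bold>\<and> \<psi>)"
| "bounded_fm \<phi> \<Longrightarrow> bounded_fm \<psi> \<Longrightarrow> bounded_fm (\<phi> \<^bold>\<or> \<psi>)"
| "bounded_fm \<phi> \<Longrightarrow> bounded_fm \<psi> \<Longrightarrow> bounded_fm (\<phi> \<^bold>\<longrightarrow> \<psi>)"
| "bounded_fm \<phi> \<Longrightarrow> x \<notin> vars_tm t \<Longrightarrow> bounded_fm (\<^bold>\<forall> x \<^bold>< t. \<phi>)"
| "bounded_fm \<phi> \<Longrightarrow> x \<notin> vars_tm t \<Longrightarrow> bounded_fm (\<^bold>\<exists> x \<^bold>< t. \<phi>)"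

definition is_Sigma1 :: "fm \<Rightarrow> bool"
  where "is_Sigma1 \<phi> \<longleftrightarrow> (\<exists>x \<theta>. \<phi> = (\<^bold>\<exists> x. \<theta>) \<and> bounded_fm \<theta>)"

definition is_Pi1 :: "fm \<Rightarrow> bool"
  where "is_Pi1 \<phi> \<longleftrightarrow> (\<exists>x \<theta>. \<phi> = (\<^bold>\<forall> x. \<theta>) \<and> bounded_fm \<theta>)"

definition is_Sigma2 :: "fm \<Rightarrow> bool"
  where "is_Sigma2 \<phi> \<longleftrightarrow> (\<exists>x \<psi>. \<phi> = (\<^bold>\<exists> x. \<psi>) \<and> is_Pi1 \<psi>)"


section \<open>Structures and satisfaction\<close>

text \<open>
  In a structure for the two-sorted language the number variables range over the whole type
  \<open>'a\<close> and the set variables over a nonempty family of subsets of \<open>'a\<close>, not necessarily the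
  full power set.
\<close>

record 'a l2_structure =
  m_zero :: 'a
  m_one :: 'a
  m_plus :: "'a \<Rightarrow> 'a \<Rightarrow> 'a"
  m_times :: "'a \<Rightarrow> 'a \<Rightarrow> 'a"
  m_less :: "'a \<Rightarrow> 'a \<Rightarrow> bool"
  m_sets :: "'a set set"

fun eval_tm :: "'a l2_structure \<Rightarrow> (nat \<Rightarrow> 'a) \<Rightarrow> tm \<Rightarrow> 'a" where
  "eval_tm M e (Var x) = e x"
| "eval_tm M e \<^bold>0 = m_zero M"
| "eval_tm M e \<^bold>1 = m_one M"
| "eval_tm M e (s \<^bold>+ t) = m_plus M (eval_tm M e s) (eval_tm M e t)"
| "eval_tm M e (s \<^bold>* t) = m_times M (eval_tm M e s) (eval_tm M e t)"

fun sat :: "'a l2_structure \<Rightarrow> (nat \<Rightarrow> 'a) \<Rightarrow> (nat \<Rightarrow> 'a set) \<Rightarrow> fm \<Rightarrow> bool" where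
  "sat M e E (s \<^bold>= t) \<longleftrightarrow> eval_tm M e s = eval_tm M e t"
| "sat M e E (s \<^bold>< t) \<longleftrightarrow> m_less M (eval_tm M e s) (eval_tm M e t)"
| "sat M e E (t \<^bold>\<in> X) \<longleftrightarrow> eval_tm M e t \<in> E X"
| "sat M e E (\<^bold>\<not> \<phi>) \<longleftrightarrow> \<not> sat M e E \<phi>"
| "sat M e E (\<phi> \<^bold>\<and> \<psi>) \<longleftrightarrow> sat M e E \<phi> \<and> sat M e E \<psi>"
| "sat M e E (\<phi> \<^bold>\<or> \<psi>) \<longleftrightarrow> sat M e E \<phi> \<or> sat M e E \<psi>"
| "sat M e E (\<phi> \<^bold>\<longrightarrow> \<psi>) \<longleftrightarrow> (sat M e E \<phi> \<longrightarrow> sat M e E \<psi>)"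
| "sat M e E (\<^bold>\<forall> x. \<phi>) \<longleftrightarrow> (\<forall>a. sat M (e(x := a)) E \<phi>)"
| "sat M e E (\<^bold>\<exists> x. \<phi>) \<longleftrightarrow> (\<exists>a. sat M (e(x := a)) E \<phi>)"
| "sat M e E (\<^bold>\<forall>\<^sub>S X. \<phi>) \<longleftrightarrow> (\<forall>A \<in> m_sets M. sat M e (E(X := A)) \<phi>)"
| "sat M e E (\<^bold>\<exists>\<^sub>S X. \<phi>) \<longleftrightarrow> (\<exists>A \<in> m_sets M. sat M e (E(X := A)) \<phi>)"

text \<open>
  Free variables of axioms are parameters: a structure is a model of \<open>T\<close> if it satisfies the
  universal closures of the members of \<open>T\<close>.
\<close>

definition models :: "'a l2_structure \<Rightarrow> fm set \<Rightarrow> bool"  (infix "\<Turnstile>" 50)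
  where "M \<Turnstile> T \<longleftrightarrow> m_sets M \<noteq> {} \<and>
    (\<forall>\<phi> \<in> T. \<forall>e E. (\<forall>X. E X \<in> m_sets M) \<longrightarrow> sat M e E \<phi>)"


section \<open>\<open>RCA\<^sub>0\<close> and \<open>\<Sigma>\<^sup>0\<^sub>2\<close>-bounding\<close>

text \<open>
  The axioms of discretely ordered semirings (nonnegative parts of discretely ordered rings),
  that is, the theory usually called \<open>PA\<^sup>-\<close>.
\<close>

definition discrete_ordered_semiring :: "fm set"
  where "discrete_ordered_semiring = (let x = Var 0; y = Var 1; z = Var 2 in
   {x \<^bold>+ y \<^bold>+ z \<^bold>= x \<^bold>+ (y \<^bold>+ z),
    x \<^bold>+ y \<^bold>= y \<^bold>+ x,
    x \<^bold>* y \<^bold>* z \<^bold>= x \<^bold>* (y \<^bold>* z),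
    x \<^bold>* y \<^bold>= y \<^bold>* x,
    x \<^bold>* (y \<^bold>+ z) \<^bold>= x \<^bold>* y \<^bold>+ x \<^bold>* z,
    x \<^bold>+ \<^bold>0 \<^bold>= x,
    x \<^bold>* \<^bold>0 \<^bold>= \<^bold>0,
    x \<^bold>* \<^bold>1 \<^bold>= x,
    x \<^bold>< y \<^bold>\<and> y \<^bold>< z \<^bold>\<longrightarrow> x \<^bold>< z,
    \<^bold>\<not> x \<^bold>< x,
    x \<^bold>< y \<^bold>\<or> x \<^bold>= y \<^bold>\<or> y \<^bold>< x,
    x \<^bold>< y \<^bold>\<longrightarrow> x \<^bold>+ z \<^bold>< y \<^bold>+ z,
    \<^bold>0 \<^bold>< z \<^bold>\<and> x \<^bold>< y \<^bold>\<longrightarrow> x \<^bold>* z \<^bold>< y \<^bold>* z,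
    x \<^bold>< y \<^bold>\<longrightarrow> (\<^bold>\<exists> 2. x \<^bold>+ z \<^bold>= y),
    \<^bold>0 \<^bold>< \<^bold>1,
    \<^bold>0 \<^bold>< x \<^bold>\<longrightarrow> \<^bold>1 \<^bold>< x \<^bold>\<or> \<^bold>1 \<^bold>= x,
    \<^bold>0 \<^bold>< x \<^bold>\<or> \<^bold>0 \<^bold>= x})"

definition Sigma1_induction :: "fm set"
  where "Sigma1_induction =
    {subst_fm x \<^bold>0 \<phi> \<^bold>\<and> (\<^bold>\<forall> x. (\<phi> \<^bold>\<longrightarrow> subst_fm x (Var x \<^bold>+ \<^bold>1) \<phi>)) \<^bold>\<longrightarrow> (\<^bold>\<forall> x. \<phi>) | x \<phi>.
      is_Sigma1 \<phi>}"

definition Delta1_comprehension :: "fm set"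
  where "Delta1_comprehension =
    {(\<^bold>\<forall> x. (\<phi> \<^bold>\<longleftrightarrow> \<psi>)) \<^bold>\<longrightarrow> (\<^bold>\<exists>\<^sub>S X. \<^bold>\<forall> x. (Var x \<^bold>\<in> X \<^bold>\<longleftrightarrow> \<phi>)) | x X \<phi> \<psi>.
      is_Sigma1 \<phi> \<and> is_Pi1 \<psi> \<and> X \<notin> fvs \<phi>}"

definition RCA0 :: "fm set"
  where "RCA0 = discrete_ordered_semiring \<union> Sigma1_induction \<union> Delta1_comprehension"

definition BSigma2 :: "fm set"
  where "BSigma2 =
    {(\<^bold>\<forall> i \<^bold>< Var n. \<^bold>\<exists> m. \<phi>) \<^bold>\<longrightarrow> (\<^bold>\<exists> k. \<^bold>\<forall> i \<^bold>< Var n. \<^bold>\<exists> m \<^bold>< Var k. \<phi>) | i n m k \<phi>.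
      is_Sigma2 \<phi> \<and> distinct [i, n, m, k] \<and> k \<notin> fvn \<phi>}"


section \<open>Partial orders and linearizability\<close>

text \<open>The usual code \<open>(s + t)\<^sup>2 + s\<close> for the ordered pair of \<open>s\<close> and \<open>t\<close>.\<close>

definition pair :: "tm \<Rightarrow> tm \<Rightarrow> tm"
  where "pair s t = (s \<^bold>+ t) \<^bold>* (s \<^bold>+ t) \<^bold>+ s"

definition ord_le :: "nat \<Rightarrow> tm \<Rightarrow> tm \<Rightarrow> fm"
  where "ord_le R s t = (pair s t \<^bold>\<in> R)"

definition ord_lt :: "nat \<Rightarrow> tm \<Rightarrow> tm \<Rightarrow> fm"
  where "ord_lt R s t = (ord_le R s t \<^bold>\<and> \<^bold>\<not> s \<^bold>= t)"

text \<open>Here and below \<open>P\<close>, \<open>R\<close> and \<open>L\<close> are names of set variables.\<close>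

definition partial_order_fm :: "nat \<Rightarrow> nat \<Rightarrow> fm"
  where "partial_order_fm P R = (let x = Var 0; y = Var 1; z = Var 2 in
    (\<^bold>\<forall> 2. (z \<^bold>\<in> R \<^bold>\<longrightarrow> (\<^bold>\<exists> 0. \<^bold>\<exists> 1. (x \<^bold>\<in> P \<^bold>\<and> y \<^bold>\<in> P \<^bold>\<and> z \<^bold>= pair x y)))) \<^bold>\<and>
    (\<^bold>\<forall> 0. (x \<^bold>\<in> P \<^bold>\<longrightarrow> ord_le R x x)) \<^bold>\<and>
    (\<^bold>\<forall> 0. \<^bold>\<forall> 1. (ord_le R x y \<^bold>\<and> ord_le R y x \<^bold>\<longrightarrow> x \<^bold>= y)) \<^bold>\<and>
    (\<^bold>\<forall> 0. \<^bold>\<forall> 1. \<^bold>\<forall> 2. (ord_le R x y \<^bold>\<and> ord_le R y z \<^bold>\<longrightarrow> ord_le R x z)))"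

definition linear_order_fm :: "nat \<Rightarrow> nat \<Rightarrow> fm"
  where "linear_order_fm P R = (let x = Var 0; y = Var 1 in
    partial_order_fm P R \<^bold>\<and> (\<^bold>\<forall> 0. \<^bold>\<forall> 1. (x \<^bold>\<in> P \<^bold>\<and> y \<^bold>\<in> P \<^bold>\<longrightarrow> ord_le R x y \<^bold>\<or> ord_le R y x)))"

definition linear_extension :: "nat \<Rightarrow> nat \<Rightarrow> nat \<Rightarrow> fm"
  where "linear_extension P R L = (let x = Var 0; y = Var 1 in
    linear_order_fm P L \<^bold>\<and> (\<^bold>\<forall> 0. \<^bold>\<forall> 1. (ord_le R x y \<^bold>\<longrightarrow> ord_le L x y)))"

definition omega_like :: "nat \<Rightarrow> nat \<Rightarrow> fm"
  where "omega_like P R = (let x = Var 0; y = Var 1; m = Var 3 in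
    \<^bold>\<forall> 0. (x \<^bold>\<in> P \<^bold>\<longrightarrow> (\<^bold>\<exists> 3. \<^bold>\<forall> 1. (y \<^bold>\<in> P \<^bold>\<and> ord_lt R y x \<^bold>\<longrightarrow> y \<^bold>< m))))"

definition omega_star_like :: "nat \<Rightarrow> nat \<Rightarrow> fm"
  where "omega_star_like P R = (let x = Var 0; y = Var 1; m = Var 3 in
    \<^bold>\<forall> 0. (x \<^bold>\<in> P \<^bold>\<longrightarrow> (\<^bold>\<exists> 3. \<^bold>\<forall> 1. (y \<^bold>\<in> P \<^bold>\<and> ord_lt R x y \<^bold>\<longrightarrow> y \<^bold>< m))))"

definition zeta_like :: "nat \<Rightarrow> nat \<Rightarrow> fm"
  where "zeta_like P R = (let x = Var 0; y = Var 1; z = Var 2; m = Var 3 in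
    \<^bold>\<forall> 0. \<^bold>\<forall> 1. (x \<^bold>\<in> P \<^bold>\<and> y \<^bold>\<in> P \<^bold>\<longrightarrow>
      (\<^bold>\<exists> 3. \<^bold>\<forall> 2. (z \<^bold>\<in> P \<^bold>\<and> ord_lt R x z \<^bold>\<and> ord_lt R z y \<^bold>\<longrightarrow> z \<^bold>< m))))"

definition linearizable :: "(nat \<Rightarrow> nat \<Rightarrow> fm) \<Rightarrow> fm"
  where "linearizable \<tau> = (let P = 0; R = 1; L = 2 in
    \<^bold>\<forall>\<^sub>S P. \<^bold>\<forall>\<^sub>S R. (partial_order_fm P R \<^bold>\<and> \<tau> P R \<^bold>\<longrightarrow>
      (\<^bold>\<exists>\<^sub>S L. (linear_extension P R L \<^bold>\<and> \<tau> P L))))"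

end

theory Submission
  imports Defs
begin

text \<open>
  Fix a model \<open>M\<close> of \<open>RCA\<^sub>0\<close>. All sets constructed below are given explicitly by bounded formulas with
  parameters, so that they belong to \<open>M\<close> by comprehension.

  \<^emph>\<open>From bounding to linearizability.\<close> For a partial order \<open>P\<close> compare \<open>x\<close> and \<open>z\<close> at the least number
  \<open>u\<close> that lies above exactly one of them in \<open>P\<close>, and put \<open>x\<close> first if it is \<open>x\<close> that lies below \<open>u\<close>. This
  is the lexicographic order on the characteristic functions of the upper cones. It is linear, it
  extends \<open>P\<close>, and \<open>u\<close> is at most \<open>x\<close> or at most \<open>z\<close> (as numbers), so it exists by bounded
  comprehension. If \<open>z\<close> comes before \<open>x\<close>, then \<open>z\<close> lies below some \<open>y \<le> x\<close> in \<open>P\<close>. Hence for an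
  \<open>\<omega>\<close>-like \<open>P\<close> the predecessors of \<open>x\<close> are contained in a union of at most \<open>x + 1\<close> finite sets, and
  bounding makes this union finite (lemma \<open>bounding_imp_omega_linear_ext\<close>). The case of \<open>\<omega>\<^sup>*\<close>
  is obtained by reversing the order.

  A \<open>\<zeta>\<close>-like \<open>P\<close> is cut into an upper part \<open>U\<close> and a lower part \<open>D\<close>: the element \<open>x\<close> goes to \<open>U\<close> if the
  numerically least element comparable with \<open>x\<close> is below or equal to \<open>x\<close>, and to \<open>D\<close> otherwise. Then
  \<open>U\<close> is upward closed, and bounding shows that \<open>U\<close> is \<open>\<omega>\<close>-like and \<open>D\<close> is \<open>\<omega>\<^sup>*\<close>-like (lemma
  \<open>zeta_split\<close>); placing a linear extension of \<open>D\<close> below one of \<open>U\<close> gives the required order.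

  \<^emph>\<open>From linearizability to bounding.\<close> Given finite sets \<open>X\<^sub>i\<close> for \<open>i < n\<close>, consider the order with a
  bottom element, tops \<open>t\<^sub>i\<close>, and a copy of \<open>X\<^sub>i\<close> between the bottom and \<open>t\<^sub>i\<close>. It is \<open>\<omega>\<close>-like and
  \<open>\<zeta>\<close>-like. In a linear extension one of the finitely many \<open>t\<^sub>i\<close> is the last, and the interval between
  the bottom and this \<open>t\<^sub>i\<close> contains all copies; if the extension is \<open>\<zeta>\<close>-like, the union of the \<open>X\<^sub>i\<close> is
  therefore bounded (lemma \<open>finite_union_bounded\<close>). To get bounding for
  \<open>\<exists>m. \<forall>y. Q i m y\<close>, let \<open>X\<^sub>i\<close> consist of the pairs \<open>\<langle>m, y\<rangle>\<close> where \<open>y\<close> is the first stage at which all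
  \<open>l \<le> m\<close> have been refuted by some \<open>z \<le> y\<close> with \<open>\<not> Q i l z\<close>. A true witness makes \<open>X\<^sub>i\<close> finite, and
  a common bound of all \<open>X\<^sub>i\<close> bounds the least witnesses (lemma \<open>linearizable_imp_bounding\<close>).

  To argue in ordinary mathematical language inside \<open>M\<close>, the first sections replace bounded formulas
  with parameters by a class \<open>delta0\<close> of predicates on environments that is closed under the logical
  operations, and translate the axiom schemes into statements about this class.
\<close>

section \<open>Renaming, substitution and free variables\<close>

fun ren_tm :: "(nat \<Rightarrow> nat) \<Rightarrow> tm \<Rightarrow> tm" where
  "ren_tm \<rho> (Var x) = Var (\<rho> x)"
| "ren_tm \<rho> \<^bold>0 = \<^bold>0"
| "ren_tm \<rho> \<^bold>1 = \<^bold>1"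
| "ren_tm \<rho> (s \<^bold>+ t) = ren_tm \<rho> s \<^bold>+ ren_tm \<rho> t"
| "ren_tm \<rho> (s \<^bold>* t) = ren_tm \<rho> s \<^bold>* ren_tm \<rho> t"

fun ren :: "(nat \<Rightarrow> nat) \<Rightarrow> (nat \<Rightarrow> nat) \<Rightarrow> fm \<Rightarrow> fm" where
  "ren \<rho> \<sigma> (s \<^bold>= t) = (ren_tm \<rho> s \<^bold>= ren_tm \<rho> t)"
| "ren \<rho> \<sigma> (s \<^bold>< t) = (ren_tm \<rho> s \<^bold>< ren_tm \<rho> t)"
| "ren \<rho> \<sigma> (t \<^bold>\<in> X) = (ren_tm \<rho> t \<^bold>\<in> \<sigma> X)"
| "ren \<rho> \<sigma> (\<^bold>\<not> \<phi>) = (\<^bold>\<not> ren \<rho> \<sigma> \<phi>)"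
| "ren \<rho> \<sigma> (\<phi> \<^bold>\<and> \<psi>) = (ren \<rho> \<sigma> \<phi> \<^bold>\<and> ren \<rho> \<sigma> \<psi>)"
| "ren \<rho> \<sigma> (\<phi> \<^bold>\<or> \<psi>) = (ren \<rho> \<sigma> \<phi> \<^bold>\<or> ren \<rho> \<sigma> \<psi>)"
| "ren \<rho> \<sigma> (\<phi> \<^bold>\<longrightarrow> \<psi>) = (ren \<rho> \<sigma> \<phi> \<^bold>\<longrightarrow> ren \<rho> \<sigma> \<psi>)"
| "ren \<rho> \<sigma> (\<^bold>\<forall> x. \<phi>) = (\<^bold>\<forall> (\<rho> x). ren \<rho> \<sigma> \<phi>)"
| "ren \<rho> \<sigma> (\<^bold>\<exists> x. \<phi>) = (\<^bold>\<exists> (\<rho> x). ren \<rho> \<sigma> \<phi>)"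
| "ren \<rho> \<sigma> (\<^bold>\<forall>\<^sub>S X. \<phi>) = (\<^bold>\<forall>\<^sub>S (\<sigma> X). ren \<rho> \<sigma> \<phi>)"
| "ren \<rho> \<sigma> (\<^bold>\<exists>\<^sub>S X. \<phi>) = (\<^bold>\<exists>\<^sub>S (\<sigma> X). ren \<rho> \<sigma> \<phi>)"

lemma eval_ren_tm: "eval_tm M e (ren_tm \<rho> t) = eval_tm M (e \<circ> \<rho>) t"
  by (induction t) auto

lemma upd_comp_inj: "inj \<rho> \<Longrightarrow> e(\<rho> x := a) \<circ> \<rho> = (e \<circ> \<rho>)(x := a)"
  by (auto simp: fun_eq_iff inj_eq)

text \<open>
  Injectivity is what prevents a renamed quantifier from capturing another variable.
\<close>

lemma sat_ren:
  assumes "inj \<rho>" "inj \<sigma>"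
  shows "sat M e E (ren \<rho> \<sigma> \<phi>) \<longleftrightarrow> sat M (e \<circ> \<rho>) (E \<circ> \<sigma>) \<phi>"
  by (induction \<phi> arbitrary: e E) (simp_all add: eval_ren_tm upd_comp_inj assms)

lemma vars_ren_tm: "vars_tm (ren_tm \<rho> t) = \<rho> ` vars_tm t"
  by (induction t) auto

lemma fvn_ren: "inj \<rho> \<Longrightarrow> fvn (ren \<rho> \<sigma> \<phi>) = \<rho> ` fvn \<phi>"
  by (induction \<phi>) (auto simp: vars_ren_tm inj_eq)

lemma bounded_ren: "bounded_fm \<phi> \<Longrightarrow> inj \<rho> \<Longrightarrow> bounded_fm (ren \<rho> \<sigma> \<phi>)"
  by (induction \<phi> rule: bounded_fm.induct)
    (auto intro!: bounded_fm.intros simp: vars_ren_tm inj_eq)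

lemma eval_tm_cong: "(\<And>x. x \<in> vars_tm t \<Longrightarrow> e x = e' x) \<Longrightarrow> eval_tm M e t = eval_tm M e' t"
  by (induction t) auto

lemma sat_cong_fvn: "(\<And>x. x \<in> fvn \<phi> \<Longrightarrow> e x = e' x) \<Longrightarrow> sat M e E \<phi> \<longleftrightarrow> sat M e' E \<phi>"
proof (induction \<phi> arbitrary: e e' E)
  case (Equal s t)
  then show ?case using eval_tm_cong[of s e e'] eval_tm_cong[of t e e'] by simp
next
  case (Less s t)
  then show ?case using eval_tm_cong[of s e e'] eval_tm_cong[of t e e'] by simp
next
  case (Mem t X)
  then show ?case using eval_tm_cong[of t e e'] by simp
next
  case (Forall x \<phi>)
  have "sat M (e(x := a)) E \<phi> = sat M (e'(x := a)) E \<phi>" for a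
    by (rule Forall.IH) (use Forall.prems in auto)
  then show ?case by simp
next
  case (Exists x \<phi>)
  have "sat M (e(x := a)) E \<phi> = sat M (e'(x := a)) E \<phi>" for a
    by (rule Exists.IH) (use Exists.prems in auto)
  then show ?case by simp
next
  case (And \<phi> \<psi>)
  have "sat M e E \<phi> = sat M e' E \<phi>" "sat M e E \<psi> = sat M e' E \<psi>"
    by (rule And.IH, use And.prems in simp)+
  then show ?case by simp
next
  case (Or \<phi> \<psi>)
  have "sat M e E \<phi> = sat M e' E \<phi>" "sat M e E \<psi> = sat M e' E \<psi>"
    by (rule Or.IH, use Or.prems in simp)+
  then show ?case by simp
next
  case (Imp \<phi> \<psi>)
  have "sat M e E \<phi> = sat M e' E \<phi>" "sat M e E \<psi> = sat M e' E \<psi>"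
    by (rule Imp.IH, use Imp.prems in simp)+
  then show ?case by simp
next
  case (Neg \<phi>)
  have "sat M e E \<phi> = sat M e' E \<phi>"
    by (rule Neg.IH, use Neg.prems in simp)
  then show ?case by simp
next
  case (ForallS X \<phi>)
  have "sat M e (E(X := A)) \<phi> = sat M e' (E(X := A)) \<phi>" for A
    by (rule ForallS.IH) (use ForallS.prems in simp)
  then show ?case by simp
next
  case (ExistsS X \<phi>)
  have "sat M e (E(X := A)) \<phi> = sat M e' (E(X := A)) \<phi>" for A
    by (rule ExistsS.IH) (use ExistsS.prems in simp)
  then show ?case by simp
qed

lemma eval_subst_tm: "eval_tm M e (subst_tm x u t) = eval_tm M (e(x := eval_tm M e u)) t"
  by (induction t) auto

lemma sat_subst_fm:
  assumes u: "vars_tm u \<subseteq> {x}"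
  shows "sat M e E (subst_fm x u \<phi>) \<longleftrightarrow> sat M (e(x := eval_tm M e u)) E \<phi>"
proof (induction \<phi> arbitrary: e E)
  case (Forall y \<phi>)
  have "eval_tm M (e(y := a)) u = eval_tm M e u" if "y \<noteq> x" for a
    by (rule eval_tm_cong) (use u that in auto)
  then have *: "sat M (e(y := a)) E (subst_fm x u \<phi>) \<longleftrightarrow> sat M (e(x := eval_tm M e u, y := a)) E \<phi>"
    if "y \<noteq> x" for a
    unfolding Forall.IH[of "e(y := a)"] using that fun_upd_twist[of y x e] by metis
  then show ?case by (cases "y = x") (simp_all del: fun_upd_apply)
next
  case (Exists y \<phi>)
  have "eval_tm M (e(y := a)) u = eval_tm M e u" if "y \<noteq> x" for a
    by (rule eval_tm_cong) (use u that in auto)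
  then have *: "sat M (e(y := a)) E (subst_fm x u \<phi>) \<longleftrightarrow> sat M (e(x := eval_tm M e u, y := a)) E \<phi>"
    if "y \<noteq> x" for a
    unfolding Exists.IH[of "e(y := a)"] using that fun_upd_twist[of y x e] by metis
  then show ?case by (cases "y = x") (simp_all del: fun_upd_apply)
qed (simp_all add: eval_subst_tm)


section \<open>Semantically bounded predicates\<close>

text \<open>
  These predicates stand for bounded formulas with parameters. Variables are de Bruijn indices, so
  that a bounded quantifier pushes its value in front of the environment; elements and sets of the
  structure occur directly as parameters. In this form the definability of a predicate written as a
  HOL term can be proved by applying introduction rules along its syntax.
\<close>

inductive term_fun :: "'a l2_structure \<Rightarrow> ((nat \<Rightarrow> 'a) \<Rightarrow> 'a) \<Rightarrow> bool" for M where
  const: "term_fun M (\<lambda>e. c)"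
| var: "term_fun M (\<lambda>e. e i)"
| plus: "term_fun M f \<Longrightarrow> term_fun M g \<Longrightarrow> term_fun M (\<lambda>e. m_plus M (f e) (g e))"
| times: "term_fun M f \<Longrightarrow> term_fun M g \<Longrightarrow> term_fun M (\<lambda>e. m_times M (f e) (g e))"

inductive delta0 :: "'a l2_structure \<Rightarrow> ((nat \<Rightarrow> 'a) \<Rightarrow> bool) \<Rightarrow> bool" for M where
  equal: "term_fun M f \<Longrightarrow> term_fun M g \<Longrightarrow> delta0 M (\<lambda>e. f e = g e)"
| less: "term_fun M f \<Longrightarrow> term_fun M g \<Longrightarrow> delta0 M (\<lambda>e. m_less M (f e) (g e))"
| mem: "A \<in> m_sets M \<Longrightarrow> term_fun M f \<Longrightarrow> delta0 M (\<lambda>e. f e \<in> A)"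
| neg: "delta0 M P \<Longrightarrow> delta0 M (\<lambda>e. \<not> P e)"
| conj: "delta0 M P \<Longrightarrow> delta0 M Q \<Longrightarrow> delta0 M (\<lambda>e. P e \<and> Q e)"
| all_less: "term_fun M f \<Longrightarrow> delta0 M P \<Longrightarrow>
    delta0 M (\<lambda>e. \<forall>a. m_less M a (f e) \<longrightarrow> P (case_nat a e))"

lemma term_fun_shift: "term_fun M f \<Longrightarrow> term_fun M (\<lambda>e. f (\<lambda>i. e (Suc i)))"
  by (induction rule: term_fun.induct) (auto intro: term_fun.intros)

lemma term_fun_subst:
  "term_fun M f \<Longrightarrow> (\<And>i. term_fun M (s i)) \<Longrightarrow> term_fun M (\<lambda>e. f (\<lambda>i. s i e))"
  by (induction rule: term_fun.induct) (auto intro: term_fun.intros)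

text \<open>
  Under a quantifier the substituted terms must skip the newly bound variable \<open>0\<close>, hence the shifted
  substitution \<open>s'\<close>.
\<close>

lemma delta0_subst:
  "delta0 M P \<Longrightarrow> (\<And>i. term_fun M (s i)) \<Longrightarrow> delta0 M (\<lambda>e. P (\<lambda>i. s i e))"
proof (induction arbitrary: s rule: delta0.induct)
  case (all_less f P)
  define s' where "s' = case_nat (\<lambda>e. e 0) (\<lambda>i e. s i (\<lambda>k. e (Suc k)))"
  have "term_fun M (s' i)" for i
    by (cases i) (auto simp: s'_def intro: term_fun.var term_fun_shift all_less.prems)
  then have "delta0 M (\<lambda>e. P (\<lambda>i. s' i e))" by (rule all_less.IH)
  with term_fun_subst[OF all_less.hyps(1) all_less.prems]
  have "delta0 M (\<lambda>e. \<forall>a. m_less M a (f (\<lambda>i. s i e)) \<longrightarrow> P (\<lambda>i. s' i (case_nat a e)))"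
    by (rule delta0.all_less)
  moreover have "(\<lambda>i. s' i (case_nat a e)) = case_nat a (\<lambda>i. s i e)" for a e
    by (auto simp: s'_def fun_eq_iff split: nat.split)
  ultimately show ?case by simp
next
  case (equal f g)
  show ?case by (rule delta0.equal[OF term_fun_subst[OF equal(1,3)] term_fun_subst[OF equal(2,3)]])
next
  case (less f g)
  show ?case by (rule delta0.less[OF term_fun_subst[OF less(1,3)] term_fun_subst[OF less(2,3)]])
next
  case (mem A f)
  show ?case by (rule delta0.mem[OF mem(1) term_fun_subst[OF mem(2,3)]])
next
  case (neg P)
  show ?case by (rule delta0.neg[OF neg.IH[OF neg.prems]])
next
  case (conj P Q)
  show ?case by (rule delta0.conj[OF conj.IH(1)[OF conj.prems] conj.IH(2)[OF conj.prems]])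
qed

text \<open>
  In this form the quantifier rules unify with any body \<open>Q a e\<close>, since \<open>Q\<close> is applied to distinct
  bound variables only. The remaining connectives are derived from the primitive ones so that they can
  be used as introduction rules as well.
\<close>

lemma delta0_all:
  assumes "term_fun M f" "delta0 M (\<lambda>e. Q (e 0) (\<lambda>i. e (Suc i)))"
  shows "delta0 M (\<lambda>e. \<forall>a. m_less M a (f e) \<longrightarrow> Q a e)"
  using delta0.all_less[where P = "\<lambda>e. Q (e 0) (\<lambda>i. e (Suc i))", OF assms] by simp

lemma delta0_ex:
  assumes "term_fun M f" "delta0 M (\<lambda>e. Q (e 0) (\<lambda>i. e (Suc i)))"
  shows "delta0 M (\<lambda>e. \<exists>a. m_less M a (f e) \<and> Q a e)"
proof -
  have "delta0 M (\<lambda>e. \<not> (\<forall>a. m_less M a (f e) \<longrightarrow> \<not> Q a e))"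
    by (rule delta0.neg, rule delta0_all, rule assms, rule delta0.neg, rule assms)
  then show ?thesis by simp
qed

lemma delta0_disj:
  assumes "delta0 M P" "delta0 M Q"
  shows "delta0 M (\<lambda>e. P e \<or> Q e)"
proof -
  have "delta0 M (\<lambda>e. \<not> (\<not> P e \<and> \<not> Q e))"
    by (rule delta0.neg[OF delta0.conj[OF delta0.neg[OF assms(1)] delta0.neg[OF assms(2)]]])
  then show ?thesis by simp
qed

lemma delta0_imp:
  assumes "delta0 M P" "delta0 M Q"
  shows "delta0 M (\<lambda>e. P e \<longrightarrow> Q e)"
proof -
  have "delta0 M (\<lambda>e. \<not> P e \<or> Q e)"
    by (rule delta0_disj[OF delta0.neg[OF assms(1)] assms(2)])
  then show ?thesis by simp
qed

lemma delta0_iff: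
  assumes "delta0 M P" "delta0 M Q"
  shows "delta0 M (\<lambda>e. P e \<longleftrightarrow> Q e)"
proof -
  have "delta0 M (\<lambda>e. (P e \<longrightarrow> Q e) \<and> (Q e \<longrightarrow> P e))"
    by (rule delta0.conj[OF delta0_imp[OF assms] delta0_imp[OF assms(2,1)]])
  moreover have "(P e \<longrightarrow> Q e) \<and> (Q e \<longrightarrow> P e) \<longleftrightarrow> (P e \<longleftrightarrow> Q e)" for e
    by blast
  ultimately show ?thesis by simp
qed

lemmas delta0_intros =
  delta0_all delta0_ex delta0.equal delta0.less delta0.mem delta0.neg delta0.conj
  delta0_disj delta0_imp delta0_iff term_fun.intros

lemma delta0_subst2:
  assumes "delta0 M (\<lambda>e. Q (e 0) (e 1))" "term_fun M f" "term_fun M g"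
  shows "delta0 M (\<lambda>e. Q (f e) (g e))"
  using delta0_subst[OF assms(1), of "\<lambda>i. if i = 0 then f else g"] assms by simp

lemma delta0_subst3:
  assumes "delta0 M (\<lambda>e. Q (e 0) (e 1) (e 2))" "term_fun M f" "term_fun M g" "term_fun M h"
  shows "delta0 M (\<lambda>e. Q (f e) (g e) (h e))"
  using delta0_subst[OF assms(1), of "\<lambda>i. if i = 0 then f else if i = 1 then g else h"] assms
  by simp

lemma term_fun_eval: "term_fun M (\<lambda>e. eval_tm M e t)"
  by (induction t) (auto intro: term_fun.intros)

text \<open>
  This converts a quantifier over the named variable \<open>x\<close> of a formula to one over index \<open>0\<close>.
\<close>

lemma delta0_shift_named:
  assumes "delta0 M P"
  shows "delta0 M (\<lambda>e. P ((\<lambda>i. e (Suc i))(x := e 0)))"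
proof -
  have "delta0 M (\<lambda>e. P (\<lambda>k. (if k = x then \<lambda>e. e 0 else (\<lambda>e. e (Suc k))) e))"
    by (rule delta0_subst[OF assms]) (simp add: term_fun.var)
  moreover have "(\<lambda>k. (if k = x then \<lambda>e. e 0 else (\<lambda>e. e (Suc k))) e) = (\<lambda>i. e (Suc i))(x := e 0)"
    for e :: "nat \<Rightarrow> 'a" by auto
  ultimately show ?thesis by simp
qed

lemma delta0_sat:
  assumes "bounded_fm \<theta>" "\<And>X. E X \<in> m_sets M"
  shows "delta0 M (\<lambda>e. sat M e E \<theta>)"
  using assms(1)
proof (induction \<theta> rule: bounded_fm.induct)
  case (8 \<phi> x t)
  have "delta0 M (\<lambda>e. sat M ((\<lambda>i. e (Suc i))(x := e 0)) E \<phi>)" by (rule delta0_shift_named[OF 8(3)])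
  from delta0_all[where Q = "\<lambda>a e. sat M (e(x := a)) E \<phi>", OF term_fun_eval this, of t]
  have "delta0 M (\<lambda>e. \<forall>a. m_less M a (eval_tm M e t) \<longrightarrow> sat M (e(x := a)) E \<phi>)" .
  moreover have "eval_tm M (e(x := a)) t = eval_tm M e t" for e a
    by (rule eval_tm_cong) (use 8 in auto)
  ultimately show ?case by simp
next
  case (9 \<phi> x t)
  have "delta0 M (\<lambda>e. sat M ((\<lambda>i. e (Suc i))(x := e 0)) E \<phi>)" by (rule delta0_shift_named[OF 9(3)])
  from delta0_ex[where Q = "\<lambda>a e. sat M (e(x := a)) E \<phi>", OF term_fun_eval this, of t]
  have "delta0 M (\<lambda>e. \<exists>a. m_less M a (eval_tm M e t) \<and> sat M (e(x := a)) E \<phi>)" .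
  moreover have "eval_tm M (e(x := a)) t = eval_tm M e t" for e a
    by (rule eval_tm_cong) (use 9 in auto)
  ultimately show ?case by simp
qed (simp_all add: delta0.intros delta0_disj delta0_imp term_fun_eval assms(2))


text \<open>
  For the converse translation, from predicates to formulas, the even variables of the formula carry
  the environment and the odd ones the parameters. When two formulas are combined, their parameters
  are merged by a second interleaving, and \<open>param_half\<close> renames the odd variables to the
  half of the merged parameters that belongs to the respective formula.
\<close>

definition interleave :: "(nat \<Rightarrow> 'b) \<Rightarrow> (nat \<Rightarrow> 'b) \<Rightarrow> nat \<Rightarrow> 'b"
  where "interleave u v j = (if even j then u (j div 2) else v (j div 2))"

definition param_half :: "bool \<Rightarrow> nat \<Rightarrow> nat"
  where "param_half b j = (if even j then j else 4 * (j div 2) + (if b then 1 else 3))"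

lemma inj_param_half: "inj (param_half b)"
proof (rule injI)
  fix i j assume *: "param_half b i = param_half b j"
  have "even (param_half b i) = even i" for i by (auto simp: param_half_def)
  from this[of i] this[of j] * have "even i = even j" by simp
  with * show "i = j" by (cases "even i") (auto simp: param_half_def elim!: oddE)
qed

lemma interleave_param_half: "interleave e (interleave u v) \<circ> param_half b = interleave e (if b then u else v)"
proof
  fix j :: nat
  have [simp]: "(4 * k + 3) div 2 = 2 * k + 1" "(4 * k + 1) div 2 = 2 * k"
    "Suc (4 * k) div 2 = 2 * k" for k :: nat by presburger+
  consider k where "j = 2 * k" | k where "j = 2 * k + 1" by (metis evenE oddE)
  then show "(interleave e (interleave u v) \<circ> param_half b) j = interleave e (if b then u else v) j"
    by cases (simp_all add: interleave_def param_half_def)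
qed

lemma interleave_double: "interleave u v \<circ> (\<lambda>j. 2 * j) = u" "interleave u v \<circ> (\<lambda>j. 2 * j + 1) = v"
  by (auto simp: fun_eq_iff interleave_def)

lemma term_fun_rep:
  "term_fun M f \<Longrightarrow> \<exists>t c. \<forall>e. f e = eval_tm M (interleave e c) t"
proof (induction rule: term_fun.induct)
  case (const c)
  have "c = eval_tm M (interleave e (\<lambda>_. c)) (Var 1)" for e by (simp add: interleave_def)
  then show ?case by blast
next
  case (var i)
  have "e i = eval_tm M (interleave e (\<lambda>_. undefined)) (Var (2 * i))" for e by (simp add: interleave_def)
  then show ?case by blast
next
  case (plus f g)
  then obtain s c t d where
    "\<forall>e. f e = eval_tm M (interleave e c) s" "\<forall>e. g e = eval_tm M (interleave e d) t" by blast
  then have "m_plus M (f e) (g e) =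
      eval_tm M (interleave e (interleave c d)) (ren_tm (param_half True) s \<^bold>+ ren_tm (param_half False) t)" for e
    by (simp add: eval_ren_tm interleave_param_half)
  then show ?case by blast
next
  case (times f g)
  then obtain s c t d where
    "\<forall>e. f e = eval_tm M (interleave e c) s" "\<forall>e. g e = eval_tm M (interleave e d) t" by blast
  then have "m_times M (f e) (g e) =
      eval_tm M (interleave e (interleave c d)) (ren_tm (param_half True) s \<^bold>* ren_tm (param_half False) t)" for e
    by (simp add: eval_ren_tm interleave_param_half)
  then show ?case by blast
qed

text \<open>
  To bind the local variable \<open>0\<close>, it is moved to the odd name \<open>1\<close>, and the other names move out of
  the way: the local variables down by one index, the parameters up by one.
\<close>
definition free_local :: "nat \<Rightarrow> nat"
  where "free_local j = (if j = 0 then 1 else if even j then j - 2 else j + 2)"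

lemma inj_free_local: "inj free_local"
proof (rule injI)
  fix i j assume *: "free_local i = free_local j"
  show "i = j"
  proof (cases "i = 0 \<or> j = 0")
    case True
    moreover have "free_local k = 1 \<longleftrightarrow> k = 0" for k unfolding free_local_def by presburger
    moreover have "free_local 0 = 1" by (simp add: free_local_def)
    ultimately show ?thesis using * by metis
  next
    case False
    then have "even (free_local i) = even i" "even (free_local j) = even j" by (auto simp: free_local_def)
    with * have "even i = even j" by simp
    with * False show ?thesis by (cases "even i") (auto simp: free_local_def elim!: evenE)
  qed
qed

lemma interleave_free_local: "(interleave e (case_nat b c))(1 := a) \<circ> free_local = interleave (case_nat a e) c"
proof
  fix j
  consider "j = 0" | i where "j = 2 * Suc i" | i where "j = Suc (2 * i)"
    by (metis nat.exhaust evenE oddE Suc_eq_plus1 mult_0_right)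
  then show "((interleave e (case_nat b c))(1 := a) \<circ> free_local) j = interleave (case_nat a e) c j"
    by cases (auto simp: interleave_def free_local_def)
qed

text \<open>
  Every predicate in the class comes from a bounded formula, so the axiom schemes of the theory apply
  to it. The set names of two formulas are merged in the same way as their parameters.
\<close>

lemma delta0_rep:
  assumes "delta0 M P" "m_sets M \<noteq> {}"
  shows "\<exists>\<theta> c E. bounded_fm \<theta> \<and> (\<forall>X. E X \<in> m_sets M) \<and> (\<forall>e. P e \<longleftrightarrow> sat M (interleave e c) E \<theta>)"
  using assms(1)
proof (induction rule: delta0.induct)
  case (equal f g)
  obtain A where A: "A \<in> m_sets M" using assms(2) by blast
  obtain s c t d where
    "\<forall>e. f e = eval_tm M (interleave e c) s" "\<forall>e. g e = eval_tm M (interleave e d) t"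
    using term_fun_rep[OF equal(1)] term_fun_rep[OF equal(2)] by blast
  then have "f e = g e \<longleftrightarrow> sat M (interleave e (interleave c d)) (\<lambda>_. A)
      (ren_tm (param_half True) s \<^bold>= ren_tm (param_half False) t)" for e
    by (simp add: eval_ren_tm interleave_param_half)
  with A show ?case
    by (intro exI[of _ "ren_tm (param_half True) s \<^bold>= ren_tm (param_half False) t"]
        exI[of _ "interleave c d"] exI[of _ "\<lambda>_. A"]) (simp add: bounded_fm.intros)
next
  case (less f g)
  obtain A where A: "A \<in> m_sets M" using assms(2) by blast
  obtain s c t d where
    "\<forall>e. f e = eval_tm M (interleave e c) s" "\<forall>e. g e = eval_tm M (interleave e d) t"
    using term_fun_rep[OF less(1)] term_fun_rep[OF less(2)] by blast
  then have "m_less M (f e) (g e) \<longleftrightarrow> sat M (interleave e (interleave c d)) (\<lambda>_. A)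
      (ren_tm (param_half True) s \<^bold>< ren_tm (param_half False) t)" for e
    by (simp add: eval_ren_tm interleave_param_half)
  with A show ?case
    by (intro exI[of _ "ren_tm (param_half True) s \<^bold>< ren_tm (param_half False) t"]
        exI[of _ "interleave c d"] exI[of _ "\<lambda>_. A"]) (simp add: bounded_fm.intros)
next
  case (mem A f)
  obtain s c where "\<forall>e. f e = eval_tm M (interleave e c) s" using term_fun_rep[OF mem(2)] by blast
  then have "f e \<in> A \<longleftrightarrow> sat M (interleave e c) (\<lambda>_. A) (s \<^bold>\<in> 0)" for e by simp
  with mem(1) show ?case
    by (intro exI[of _ "s \<^bold>\<in> 0"] exI[of _ c] exI[of _ "\<lambda>_. A"]) (simp add: bounded_fm.intros)
next
  case (neg P)
  then obtain \<theta> c E where "bounded_fm \<theta>" "\<forall>X. E X \<in> m_sets M" "\<forall>e. P e \<longleftrightarrow> sat M (interleave e c) E \<theta>"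
    by blast
  then show ?case
    by (intro exI[of _ "\<^bold>\<not> \<theta>"] exI[of _ c] exI[of _ E]) (auto intro: bounded_fm.intros)
next
  case (conj P Q)
  then obtain \<theta> c E \<theta>' c' E' where *:
    "bounded_fm \<theta>" "\<forall>X. E X \<in> m_sets M" "\<forall>e. P e \<longleftrightarrow> sat M (interleave e c) E \<theta>"
    "bounded_fm \<theta>'" "\<forall>X. E' X \<in> m_sets M" "\<forall>e. Q e \<longleftrightarrow> sat M (interleave e c') E' \<theta>'"
    by blast
  let ?\<phi> = "ren (param_half True) (\<lambda>j. 2 * j) \<theta> \<^bold>\<and> ren (param_half False) (\<lambda>j. 2 * j + 1) \<theta>'"
  have "inj (\<lambda>j::nat. 2 * j)" "inj (\<lambda>j::nat. 2 * j + 1)" by (auto simp: inj_def)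
  note inj = inj_param_half this
  have "bounded_fm ?\<phi>"
    by (intro bounded_fm.intros bounded_ren * inj)
  moreover have "\<forall>X. interleave E E' X \<in> m_sets M" using * by (simp add: interleave_def)
  moreover have "P e \<and> Q e \<longleftrightarrow> sat M (interleave e (interleave c c')) (interleave E E') ?\<phi>" for e
    using * by (simp add: sat_ren[OF inj(1,2)] sat_ren[OF inj(1,3)[simplified]] interleave_param_half interleave_double interleave_double[simplified])
  ultimately show ?case by blast
next
  case (all_less f P)
  then obtain \<theta> d E where *:
    "bounded_fm \<theta>" "\<forall>X. E X \<in> m_sets M" "\<forall>e. P e \<longleftrightarrow> sat M (interleave e d) E \<theta>"
    by blast
  obtain t c where t: "\<forall>e. f e = eval_tm M (interleave e c) t" using term_fun_rep[OF all_less(1)] by blast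
  define \<theta>' where "\<theta>' = ren (free_local \<circ> param_half False) id \<theta>"
  define sh where "sh = (\<lambda>j::nat. if even j then j else j + 2)"
  define t' where "t' = ren_tm (sh \<circ> param_half True) t"
  have inj: "inj (free_local \<circ> param_half False)" by (intro inj_compose inj_free_local inj_param_half)
  have fresh: "1 \<notin> vars_tm t'"
    by (auto simp: t'_def vars_ren_tm sh_def split: if_splits)
  have sh: "(interleave e (case_nat x v))(1 := a) \<circ> sh = interleave e v" for a e v and x :: 'a
  proof
    fix j show "((interleave e (case_nat x v))(1 := a) \<circ> sh) j = interleave e v j"
      by (cases "even j") (auto simp: interleave_def sh_def elim!: oddE)
  qed
  (* The parameter with name 1 is a dummy: this name belongs to the quantifier. *)
  let ?c = "case_nat undefined (interleave c d)"
  have "eval_tm M ((interleave e ?c)(1 := a)) t' = f e" for e a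
    unfolding t'_def eval_ren_tm comp_assoc[symmetric] sh interleave_param_half using t by simp
  moreover have "sat M ((interleave e ?c)(1 := a)) E \<theta>' = P (case_nat a e)" for e a
    unfolding \<theta>'_def sat_ren[OF inj inj_on_id] comp_assoc[symmetric] interleave_free_local interleave_param_half
    using * by simp
  ultimately have "(\<forall>a. m_less M a (f e) \<longrightarrow> P (case_nat a e)) \<longleftrightarrow>
      sat M (interleave e ?c) E (\<^bold>\<forall> 1 \<^bold>< t'. \<theta>')" for e
    by simp
  moreover have "bounded_fm (\<^bold>\<forall> 1 \<^bold>< t'. \<theta>')"
    by (intro bounded_fm.intros fresh) (simp add: \<theta>'_def bounded_ren * inj)
  ultimately show ?case using *(2) by blast
qed


section \<open>Arithmetic and pairing in a model of \<open>RCA\<^sub>0\<close>\<close>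

locale rca0_model =
  fixes M :: "'a l2_structure"
  assumes RCA0: "M \<Turnstile> RCA0"
begin

abbreviation sets :: "'a set set" where "sets \<equiv> m_sets M"
abbreviation zero :: 'a  ("\<zero>") where "\<zero> \<equiv> m_zero M"
abbreviation one :: 'a  ("\<one>") where "\<one> \<equiv> m_one M"
abbreviation plus :: "'a \<Rightarrow> 'a \<Rightarrow> 'a"  (infixl "\<oplus>" 65) where "x \<oplus> y \<equiv> m_plus M x y"
abbreviation times :: "'a \<Rightarrow> 'a \<Rightarrow> 'a"  (infixl "\<otimes>" 70) where "x \<otimes> y \<equiv> m_times M x y"
abbreviation less :: "'a \<Rightarrow> 'a \<Rightarrow> bool"  (infix "\<prec>" 50) where "x \<prec> y \<equiv> m_less M x y"

text \<open>
  A constant and not an abbreviation, since otherwise the library's simplification rules relating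
  \<open>\<le>\<close> with the negation of \<open><\<close> would rewrite a term to itself.
\<close>
definition less_eq :: "'a \<Rightarrow> 'a \<Rightarrow> bool"  (infix "\<preceq>" 50) where "x \<preceq> y \<longleftrightarrow> \<not> y \<prec> x"

lemma sets_nonempty: "sets \<noteq> {}"
  using RCA0 by (simp add: models_def)

lemma RCA0_axiom: "\<phi> \<in> RCA0 \<Longrightarrow> (\<And>X. E X \<in> sets) \<Longrightarrow> sat M e E \<phi>"
  using RCA0 by (simp add: models_def)

lemma semiring_axiom:
  "\<forall>\<phi> \<in> discrete_ordered_semiring.
    sat M (case_nat x (case_nat y (\<lambda>_. z))) (\<lambda>_. SOME A. A \<in> sets) \<phi>"
  using sets_nonempty by (auto intro!: RCA0_axiom simp: RCA0_def some_in_eq)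

lemma semiring_laws:
  "x \<oplus> y \<oplus> z = x \<oplus> (y \<oplus> z) \<and>
   x \<oplus> y = y \<oplus> x \<and>
   x \<otimes> y \<otimes> z = x \<otimes> (y \<otimes> z) \<and>
   x \<otimes> y = y \<otimes> x \<and>
   x \<otimes> (y \<oplus> z) = x \<otimes> y \<oplus> x \<otimes> z \<and>
   x \<oplus> \<zero> = x \<and>
   x \<otimes> \<zero> = \<zero> \<and>
   x \<otimes> \<one> = x \<and>
   (x \<prec> y \<and> y \<prec> z \<longrightarrow> x \<prec> z) \<and>
   \<not> x \<prec> x \<and>
   (x \<prec> y \<or> x = y \<or> y \<prec> x) \<and>
   (x \<prec> y \<longrightarrow> x \<oplus> z \<prec> y \<oplus> z) \<and>
   (\<zero> \<prec> z \<and> x \<prec> y \<longrightarrow> x \<otimes> z \<prec> y \<otimes> z) \<and>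
   (x \<prec> y \<longrightarrow> (\<exists>z. x \<oplus> z = y)) \<and>
   \<zero> \<prec> \<one> \<and>
   (\<zero> \<prec> x \<longrightarrow> \<one> \<prec> x \<or> \<one> = x) \<and>
   (\<zero> \<prec> x \<or> \<zero> = x)"
  using semiring_axiom[unfolded discrete_ordered_semiring_def Let_def, of x y z]
  by (simp (no_asm_use) add: numeral_2_eq_2)

lemma
  shows add_comm: "x \<oplus> y = y \<oplus> x"
    and mult_comm: "x \<otimes> y = y \<otimes> x"
    and distrib: "x \<otimes> (y \<oplus> z) = x \<otimes> y \<oplus> x \<otimes> z"
    and add_zero: "x \<oplus> \<zero> = x"
    and mult_zero: "x \<otimes> \<zero> = \<zero>"
    and mult_one: "x \<otimes> \<one> = x"
    and less_trans: "x \<prec> y \<Longrightarrow> y \<prec> z \<Longrightarrow> x \<prec> z"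
    and less_irrefl: "\<not> x \<prec> x"
    and less_linear: "x \<prec> y \<or> x = y \<or> y \<prec> x"
    and add_mono: "x \<prec> y \<Longrightarrow> x \<oplus> z \<prec> y \<oplus> z"
    and mult_mono: "\<zero> \<prec> z \<Longrightarrow> x \<prec> y \<Longrightarrow> x \<otimes> z \<prec> y \<otimes> z"
    and less_diff: "x \<prec> y \<Longrightarrow> \<exists>z. x \<oplus> z = y"
    and zero_less_one: "\<zero> \<prec> \<one>"
    and discrete: "\<zero> \<prec> x \<Longrightarrow> \<one> \<prec> x \<or> \<one> = x"
    and zero_least: "\<zero> \<prec> x \<or> \<zero> = x"
  by (insert semiring_laws[of x y z]; elim conjE; (assumption | meson))+

sublocale ord: linorder "(\<preceq>)" "(\<prec>)"
proof
  fix x y z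
  show "x \<prec> y \<longleftrightarrow> x \<preceq> y \<and> \<not> y \<preceq> x"
    unfolding less_eq_def using less_trans[of x y x] less_irrefl by blast
  show "x \<preceq> x" unfolding less_eq_def by (rule less_irrefl)
  show "x \<preceq> z" if "x \<preceq> y" "y \<preceq> z"
    using that less_linear[of x y] less_trans[of z x y] unfolding less_eq_def by blast
  show "x = y" if "x \<preceq> y" "y \<preceq> x"
    using that less_linear[of x y] unfolding less_eq_def by blast
  show "x \<preceq> y \<or> y \<preceq> x"
    using less_trans[of x y x] less_irrefl unfolding less_eq_def by blast
qed

lemma zero_le: "\<zero> \<preceq> x"
  using zero_least[of x] by (auto simp: ord.le_less)

lemma not_less_zero: "\<not> x \<prec> \<zero>"
  using zero_le[of x] by order

lemma add_mono_le: "x \<preceq> y \<Longrightarrow> x \<oplus> z \<preceq> y \<oplus> z"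
  using add_mono[of x y z] by (auto simp: ord.le_less)

lemma add_mono_le2:
  assumes "x \<preceq> y" "u \<preceq> v"
  shows "x \<oplus> u \<preceq> y \<oplus> v"
proof -
  have "x \<oplus> u \<preceq> y \<oplus> u" "u \<oplus> y \<preceq> v \<oplus> y" by (rule add_mono_le, fact)+
  then show ?thesis by (metis add_comm ord.order_trans)
qed

lemma mult_mono_le: "x \<preceq> y \<Longrightarrow> x \<otimes> z \<preceq> y \<otimes> z"
  using mult_mono[of z x y] zero_least[of z]
  by (auto simp: mult_zero ord.le_less)

lemma mult_mono_le2:
  assumes "x \<preceq> y" "u \<preceq> v"
  shows "x \<otimes> u \<preceq> y \<otimes> v"
proof -
  have "x \<otimes> u \<preceq> y \<otimes> u" "u \<otimes> y \<preceq> v \<otimes> y" by (rule mult_mono_le, fact)+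
  then show ?thesis by (metis mult_comm ord.order_trans)
qed

lemma le_add: "x \<preceq> x \<oplus> y" "x \<preceq> y \<oplus> x"
proof -
  have "\<zero> \<oplus> x \<preceq> y \<oplus> x" by (rule add_mono_le[OF zero_le])
  then show "x \<preceq> y \<oplus> x" by (simp add: add_comm[of \<zero>] add_zero)
  then show "x \<preceq> x \<oplus> y" by (simp add: add_comm)
qed

text \<open>
  Bounded quantifiers are strict, so the translation of \<open>\<preceq>\<close> into \<open>\<prec>\<close> is used for every bound below.
  It rests on discreteness: a positive difference is at least \<open>\<one>\<close>.
\<close>

lemma less_succ_iff: "x \<prec> y \<oplus> \<one> \<longleftrightarrow> x \<preceq> y"
proof
  assume "x \<preceq> y"
  moreover have "\<zero> \<oplus> y \<prec> \<one> \<oplus> y" by (rule add_mono[OF zero_less_one])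
  then have "y \<prec> y \<oplus> \<one>" by (simp add: add_comm[of _ y] add_zero)
  ultimately show "x \<prec> y \<oplus> \<one>" by order
next
  assume *: "x \<prec> y \<oplus> \<one>"
  show "x \<preceq> y"
  proof (rule ccontr)
    assume "\<not> x \<preceq> y"
    then have "y \<prec> x" by order
    then obtain z where z: "y \<oplus> z = x" using less_diff by blast
    with \<open>y \<prec> x\<close> have "z \<noteq> \<zero>" by (auto simp: add_zero)
    then have "\<one> \<preceq> z" using discrete[of z] zero_least[of z] by (auto simp: ord.le_less)
    then have "\<one> \<oplus> y \<preceq> z \<oplus> y" by (rule add_mono_le)
    with z * show False by (simp add: add_comm[of _ y])
  qed
qed

definition pr :: "'a \<Rightarrow> 'a \<Rightarrow> 'a"  ("\<langle>_,/ _\<rangle>")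
  where "\<langle>x, y\<rangle> = (x \<oplus> y) \<otimes> (x \<oplus> y) \<oplus> x"

lemma pr_mono: "x \<preceq> x' \<Longrightarrow> y \<preceq> y' \<Longrightarrow> \<langle>x, y\<rangle> \<preceq> \<langle>x', y'\<rangle>"
  unfolding pr_def by (intro add_mono_le2 mult_mono_le2)

lemma le_square: "x \<preceq> x \<otimes> x"
proof (cases "x = \<zero>")
  case False
  then have "\<one> \<preceq> x" using zero_least[of x] discrete[of x] by (auto simp: ord.le_less)
  with mult_mono_le[OF this, of x] show ?thesis by (simp add: mult_one mult_comm[of \<one>])
qed (simp add: mult_zero)

text \<open>
  This makes quantification over the components of a coded pair a bounded quantification.
\<close>

lemma le_pr: "x \<preceq> \<langle>x, y\<rangle>" "y \<preceq> \<langle>x, y\<rangle>"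
proof -
  show "x \<preceq> \<langle>x, y\<rangle>" unfolding pr_def by (rule le_add)
  have "y \<preceq> x \<oplus> y" "x \<oplus> y \<preceq> (x \<oplus> y) \<otimes> (x \<oplus> y)"
    "(x \<oplus> y) \<otimes> (x \<oplus> y) \<preceq> \<langle>x, y\<rangle>"
    unfolding pr_def by (rule le_add le_square)+
  then show "y \<preceq> \<langle>x, y\<rangle>" by order
qed

text \<open>
  The code \<open>u\<^sup>2 + x\<close> with \<open>u = x + y\<close> lies between \<open>u\<^sup>2\<close> and \<open>u\<^sup>2 + u < (u + 1)\<^sup>2\<close>, so codes are ordered
  first by the sum of the components. Injectivity follows.
\<close>

lemma pr_less: "x \<oplus> y \<prec> x' \<oplus> y' \<Longrightarrow> \<langle>x, y\<rangle> \<prec> \<langle>x', y'\<rangle>"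
proof -
  define u v where "u = x \<oplus> y" and "v = x' \<oplus> y'"
  assume "x \<oplus> y \<prec> x' \<oplus> y'"
  then have uv: "u \<oplus> \<one> \<preceq> v"
    unfolding u_def[symmetric] v_def[symmetric] by (metis less_succ_iff ord.not_less)
  have "\<langle>x, y\<rangle> \<preceq> u \<otimes> u \<oplus> u"
    unfolding pr_def u_def by (intro add_mono_le2 le_add ord.order_refl)
  moreover have "u \<otimes> u \<oplus> u \<prec> (u \<oplus> \<one>) \<otimes> (u \<oplus> \<one>)"
  proof -
    have "u \<otimes> u \<oplus> u = u \<otimes> (u \<oplus> \<one>)" by (simp add: distrib mult_one)
    moreover have "u \<prec> u \<oplus> \<one>" by (simp add: less_succ_iff)
    moreover have "\<zero> \<prec> u \<oplus> \<one>" by (simp add: less_succ_iff zero_le)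
    ultimately show ?thesis using mult_mono[of "u \<oplus> \<one>" u "u \<oplus> \<one>"] by simp
  qed
  moreover have "(u \<oplus> \<one>) \<otimes> (u \<oplus> \<one>) \<preceq> v \<otimes> v" using uv by (rule mult_mono_le2[OF _ uv])
  moreover have "v \<otimes> v \<preceq> \<langle>x', y'\<rangle>" unfolding pr_def v_def by (rule le_add)
  ultimately show ?thesis by order
qed

lemma add_cancel: "z \<oplus> x = z \<oplus> y \<Longrightarrow> x = y"
  using add_mono[of x y z] add_mono[of y x z] less_linear[of x y] by (auto simp: add_comm)

lemma pr_inject [simp]: "\<langle>x, y\<rangle> = \<langle>x', y'\<rangle> \<longleftrightarrow> x = x' \<and> y = y'"
proof
  assume eq: "\<langle>x, y\<rangle> = \<langle>x', y'\<rangle>"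
  have u: "x \<oplus> y = x' \<oplus> y'"
    using pr_less[of x y x' y'] pr_less[of x' y' x y] eq less_linear[of "x \<oplus> y" "x' \<oplus> y'"]
    by auto
  then have "x = x'" using eq by (auto simp: pr_def dest: add_cancel)
  with u show "x = x' \<and> y = y'" by (auto dest: add_cancel)
qed simp

section \<open>Induction and comprehension\<close>

lemma term_fun_pr: "term_fun M f \<Longrightarrow> term_fun M g \<Longrightarrow> term_fun M (\<lambda>e. \<langle>f e, g e\<rangle>)"
  unfolding pr_def by (rule term_fun.plus[OF term_fun.times[OF term_fun.plus term_fun.plus]])

lemma delta0_le: "term_fun M f \<Longrightarrow> term_fun M g \<Longrightarrow> delta0 M (\<lambda>e. f e \<preceq> g e)"
  unfolding less_eq_def by (intro delta0.neg delta0.less)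

lemmas definable = delta0_intros delta0_le term_fun_pr

text \<open>
  The local variable with index \<open>i\<close> has the name \<open>2 * i\<close>. In the formulas below, the names \<open>0\<close>, \<open>2\<close>, \<open>4\<close>
  thus stand for the first three arguments of the represented predicate.
\<close>

lemma interleave_upd: "(interleave e c)(2 * i := a) = interleave (e(i := a)) c"
  by (auto simp: fun_eq_iff interleave_def)

lemma sigma1_induct:
  assumes D: "delta0 M (\<lambda>e. Q (e 0) (e 1))"
    and base: "\<exists>y. Q \<zero> y"
    and step: "\<And>x. \<exists>y. Q x y \<Longrightarrow> \<exists>y. Q (x \<oplus> \<one>) y"
  shows "\<exists>y. Q x y"
proof -
  obtain \<theta> c E where \<theta>: "bounded_fm \<theta>" "\<forall>X. E X \<in> sets"
    and Q: "\<And>e. Q (e 0) (e 1) \<longleftrightarrow> sat M (interleave e c) E \<theta>"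
    using delta0_rep[OF D sets_nonempty] by blast
  let ?\<phi> = "\<^bold>\<exists> 2. \<theta>"
  have Q': "sat M (interleave e c) E ?\<phi> \<longleftrightarrow> (\<exists>y. Q (e 0) y)" for e
    using interleave_upd[of e c 1] by (simp add: Q[symmetric])
  have upd0: "(interleave e c)(0 := a) = interleave (e(0 := a)) c" for e a using interleave_upd[of e c 0] by simp
  have ev: "eval_tm M (interleave e c) (Var 0 \<^bold>+ \<^bold>1) = e 0 \<oplus> \<one>" for e by (simp add: interleave_def)
  let ?ind = "subst_fm 0 \<^bold>0 ?\<phi> \<^bold>\<and> (\<^bold>\<forall> 0. (?\<phi> \<^bold>\<longrightarrow> subst_fm 0 (Var 0 \<^bold>+ \<^bold>1) ?\<phi>)) \<^bold>\<longrightarrow> (\<^bold>\<forall> 0. ?\<phi>)"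
  have "?ind \<in> Sigma1_induction"
    unfolding Sigma1_induction_def is_Sigma1_def
    by (rule CollectI, rule exI[of _ 0], rule exI[of _ ?\<phi>]) (use \<theta>(1) in blast)
  then have ind: "sat M (interleave (\<lambda>_. \<zero>) c) E ?ind"
    using \<theta>(2) by (intro RCA0_axiom) (auto simp: RCA0_def)
  have zero: "sat M (interleave (\<lambda>_. \<zero>) c) E (subst_fm 0 \<^bold>0 ?\<phi>)"
    using base by (subst sat_subst_fm) (simp_all only: eval_tm.simps vars_tm.simps upd0 Q', simp_all)
  have succ: "sat M (interleave e c) E (subst_fm 0 (Var 0 \<^bold>+ \<^bold>1) ?\<phi>) \<longleftrightarrow> (\<exists>y. Q (e 0 \<oplus> \<one>) y)" for e
    by (subst sat_subst_fm) (simp_all only: ev upd0 Q' vars_tm.simps, simp_all)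
  have all: "sat M (interleave (\<lambda>_. \<zero>) c) E (\<^bold>\<forall> 0. \<chi>) \<longleftrightarrow>
      (\<forall>a. sat M (interleave ((\<lambda>_. \<zero>)(0 := a)) c) E \<chi>)" for \<chi>
    by (simp only: sat.simps(8) upd0)
  have step': "sat M (interleave (\<lambda>_. \<zero>) c) E (\<^bold>\<forall> 0. (?\<phi> \<^bold>\<longrightarrow> subst_fm 0 (Var 0 \<^bold>+ \<^bold>1) ?\<phi>))"
    unfolding all sat.simps(7) succ Q' by (intro allI impI) (rule step)
  have "sat M (interleave (\<lambda>_. \<zero>) c) E (\<^bold>\<forall> 0. ?\<phi>)"
    by (rule mp[OF ind[unfolded sat.simps(7)[of _ _ _ "_ \<^bold>\<and> _"] sat.simps(5)] conjI[OF zero step']])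
  then have "\<forall>a. \<exists>y. Q a y" unfolding all Q' fun_upd_same .
  then show ?thesis by (rule spec)
qed

lemma delta0_induct:
  assumes "delta0 M (\<lambda>e. P (e 0))" "P \<zero>" "\<And>x. P x \<Longrightarrow> P (x \<oplus> \<one>)"
  shows "P x"
proof -
  have "\<exists>y::'a. P x"
    by (rule sigma1_induct[of "\<lambda>x y. P x"]) (simp_all add: assms)
  then show ?thesis by simp
qed

lemma least_number:
  assumes D: "delta0 M (\<lambda>e. P (e 0))" and "P x"
  obtains y where "P y" "\<And>z. z \<prec> y \<Longrightarrow> \<not> P z"
proof (rule ccontr)
  assume none: "\<not> thesis"
  have "\<forall>z. z \<prec> x \<longrightarrow> \<not> P z" for x
  proof (rule delta0_induct[of "\<lambda>x. \<forall>z. z \<prec> x \<longrightarrow> \<not> P z"])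
    have "delta0 M (\<lambda>e. P (e 0))" by (rule D)
    then show "delta0 M (\<lambda>e. \<forall>z. z \<prec> e 0 \<longrightarrow> \<not> P z)"
      by (intro delta0_all term_fun.var delta0.neg)
    show "\<forall>z. z \<prec> \<zero> \<longrightarrow> \<not> P z" by (simp add: not_less_zero)
    fix x assume *: "\<forall>z. z \<prec> x \<longrightarrow> \<not> P z"
    have "\<not> P x"
    proof
      assume "P x"
      then have thesis by (rule that) (use * in blast)
      with none show False ..
    qed
    with * show "\<forall>z. z \<prec> x \<oplus> \<one> \<longrightarrow> \<not> P z"
      by (auto simp: less_succ_iff ord.le_less)
  qed
  from this[of "x \<oplus> \<one>"] \<open>P x\<close> show False by (simp add: less_succ_iff)
qed

text \<open>
  A bounded formula is both \<open>\<Sigma>\<^sup>0\<^sub>1\<close> and \<open>\<Pi>\<^sup>0\<^sub>1\<close> by a vacuous quantifier, here over the name \<open>2\<close>. The set names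
  are shifted to make \<open>0\<close> available for the set that is to be formed.
\<close>

lemma comprehension:
  assumes "delta0 M (\<lambda>e. P (e 0))"
  shows "{x. P x} \<in> sets"
proof -
  obtain \<theta>0 c E where \<theta>0: "bounded_fm \<theta>0" "\<forall>X. E X \<in> sets"
    and P0: "\<And>e. P (e 0) \<longleftrightarrow> sat M (interleave e c) E \<theta>0"
    using delta0_rep[OF assms sets_nonempty] by blast
  define \<theta> where "\<theta> = ren id Suc \<theta>0"
  have \<theta>: "bounded_fm \<theta>" unfolding \<theta>_def by (rule bounded_ren[OF \<theta>0(1) inj_on_id])
  have P: "sat M (interleave e c) (case_nat A E) \<theta> \<longleftrightarrow> P (e 0)" for e A
    unfolding \<theta>_def sat_ren[OF inj_on_id inj_Suc] using P0[of e]
    by (simp add: comp_def)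
  have upd0: "(interleave e c)(0 := a) = interleave (e(0 := a)) c" for e a using interleave_upd[of e c 0] by simp
  have upd2: "(interleave e c)(2 := a) = interleave (e(1 := a)) c" for e a using interleave_upd[of e c 1] by simp
  have "0 \<notin> fvs \<theta>"
  proof -
    have "fvs (ren \<rho> Suc \<phi>) \<subseteq> range Suc" for \<rho> \<phi>
      by (induction \<phi>) auto
    then show ?thesis unfolding \<theta>_def by blast
  qed
  let ?ca = "(\<^bold>\<forall> 0. ((\<^bold>\<exists> 2. \<theta>) \<^bold>\<longleftrightarrow> (\<^bold>\<forall> 2. \<theta>))) \<^bold>\<longrightarrow> (\<^bold>\<exists>\<^sub>S 0. \<^bold>\<forall> 0. (Var 0 \<^bold>\<in> 0 \<^bold>\<longleftrightarrow> (\<^bold>\<exists> 2. \<theta>)))"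
  have "?ca \<in> Delta1_comprehension"
    unfolding Delta1_comprehension_def is_Sigma1_def is_Pi1_def mem_Collect_eq
    by (rule exI[of _ 0], rule exI[of _ 0], rule exI[of _ "\<^bold>\<exists> 2. \<theta>"], rule exI[of _ "\<^bold>\<forall> 2. \<theta>"])
      (use \<theta> \<open>0 \<notin> fvs \<theta>\<close> in simp)
  then have "sat M (interleave (\<lambda>_. \<zero>) c) (case_nat (E 0) E) ?ca"
    using \<theta>0(2) by (intro RCA0_axiom) (auto simp: RCA0_def split: nat.split)
  moreover have "(case_nat (E 0) E)(0 := A) = case_nat A E" for A
    by (auto simp: fun_eq_iff split: nat.split)
  ultimately obtain A where "A \<in> sets" "\<forall>a. a \<in> A \<longleftrightarrow> P a"
    by (auto simp only: sat.simps upd0 upd2 P) (auto simp: interleave_def)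
  then have "A = {x. P x}" by blast
  with \<open>A \<in> sets\<close> show ?thesis by simp
qed

section \<open>\<open>\<Sigma>\<^sup>0\<^sub>2\<close>-bounding\<close>

text \<open>
  Bounding for \<open>\<Pi>\<^sup>0\<^sub>1\<close> predicates. It amounts to bounding for \<open>\<Sigma>\<^sup>0\<^sub>2\<close>, because a leading
  existential quantifier can be merged with the witness \<open>m\<close> by pairing.
\<close>

definition bounding :: bool where
  "bounding \<longleftrightarrow> (\<forall>Q n. delta0 M (\<lambda>e. Q (e 0) (e 1) (e 2)) \<longrightarrow>
    (\<forall>i. i \<prec> n \<longrightarrow> (\<exists>m. \<forall>y. Q i m y)) \<longrightarrow> (\<exists>k. \<forall>i. i \<prec> n \<longrightarrow> (\<exists>m. m \<prec> k \<and> (\<forall>y. Q i m y))))"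

lemma models_BSigma2_imp_bounding:
  assumes "M \<Turnstile> BSigma2"
  shows bounding
  unfolding bounding_def
proof (intro allI impI)
  fix Q n
  assume D: "delta0 M (\<lambda>e. Q (e 0) (e 1) (e 2))"
    and hyp: "\<forall>i. i \<prec> n \<longrightarrow> (\<exists>m. \<forall>y. Q i m y)"
  obtain \<theta>0 c E where \<theta>0: "bounded_fm \<theta>0" "\<forall>X. E X \<in> sets"
    and Q0: "\<And>e. Q (e 0) (e 1) (e 2) \<longleftrightarrow> sat M (interleave e c) E \<theta>0"
    using delta0_rep[OF D sets_nonempty] by blast
  (* After doubling, the arguments i, m, y have the names 0, 4, 8, and every odd name is fresh:
     1 is used for the bound n, 3 for the vacuous existential quantifier and 5 for the bound k. *)
  define \<theta> where "\<theta> = ren (\<lambda>j. 2 * j) id \<theta>0"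
  have inj: "inj (\<lambda>j::nat. 2 * j)" by (auto simp: inj_def)
  have \<theta>: "bounded_fm \<theta>" unfolding \<theta>_def by (rule bounded_ren[OF \<theta>0(1) inj])
  have fv: "5 \<notin> fvn \<theta>"
    unfolding \<theta>_def fvn_ren[OF inj] by (auto simp: image_iff; presburger)
  have Q: "sat M e E \<theta> \<longleftrightarrow> Q (e 0) (e 4) (e 8)" if "e \<circ> (\<lambda>j. 2 * j) = interleave f c" for e f
  proof -
    have "f 0 = e 0" "f 1 = e 4" "f 2 = e 8"
      using fun_cong[OF that, of 0] fun_cong[OF that, of 2] fun_cong[OF that, of 4]
      by (simp_all add: interleave_def)
    then show ?thesis
      unfolding \<theta>_def sat_ren[OF inj inj_on_id] that using Q0[of f] by simp
  qed
  define e0 where "e0 = (\<lambda>j. if j = 1 then n else interleave (\<lambda>_. \<zero>) c (j div 2))"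
  have interleave: "interleave ((\<lambda>_. \<zero>)(0 := i, 1 := m, 2 := y)) c = (interleave (\<lambda>_. \<zero>) c)(0 := i, 2 := m, 4 := y)" for i m y
    using interleave_upd[of _ c 0] interleave_upd[of _ c 1] interleave_upd[of _ c 2] by simp
  have upd: "sat M (e0(5 := k, 0 := i, 4 := m, 3 := x, 8 := y)) E \<theta> \<longleftrightarrow> Q i m y"
    "sat M (e0(0 := i, 4 := m, 3 := x, 8 := y)) E \<theta> \<longleftrightarrow> Q i m y" for k i m x y
  proof -
    have "2 * j \<noteq> 5" "2 * j \<noteq> 3" "2 * j \<noteq> Suc 0" for j :: nat by presburger+
    then have "(e0(5 := k, 0 := i, 4 := m, 3 := x, 8 := y)) \<circ> (\<lambda>j. 2 * j) = interleave ((\<lambda>_. \<zero>)(0 := i, 1 := m, 2 := y)) c"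
      "(e0(0 := i, 4 := m, 3 := x, 8 := y)) \<circ> (\<lambda>j. 2 * j) = interleave ((\<lambda>_. \<zero>)(0 := i, 1 := m, 2 := y)) c"
      unfolding interleave by (auto simp: fun_eq_iff e0_def)
    from this[THEN Q] show "sat M (e0(5 := k, 0 := i, 4 := m, 3 := x, 8 := y)) E \<theta> \<longleftrightarrow> Q i m y"
      "sat M (e0(0 := i, 4 := m, 3 := x, 8 := y)) E \<theta> \<longleftrightarrow> Q i m y" by simp_all
  qed
  let ?ax = "(\<^bold>\<forall> 0 \<^bold>< Var 1. \<^bold>\<exists> 4. \<^bold>\<exists> 3. \<^bold>\<forall> 8. \<theta>) \<^bold>\<longrightarrow>
    (\<^bold>\<exists> 5. \<^bold>\<forall> 0 \<^bold>< Var 1. \<^bold>\<exists> 4 \<^bold>< Var 5. \<^bold>\<exists> 3. \<^bold>\<forall> 8. \<theta>)"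
  have "?ax \<in> BSigma2"
    unfolding BSigma2_def mem_Collect_eq is_Sigma2_def is_Pi1_def
    by (rule exI[of _ 0], rule exI[of _ 1], rule exI[of _ 4], rule exI[of _ 5],
        rule exI[of _ "\<^bold>\<exists> 3. \<^bold>\<forall> 8. \<theta>"]) (use \<theta> fv in simp)
  then have "sat M e0 E ?ax" using assms \<theta>0(2) unfolding models_def by blast
  moreover have "e0 (Suc 0) = n" by (simp add: e0_def)
  ultimately show "\<exists>k. \<forall>i. i \<prec> n \<longrightarrow> (\<exists>m. m \<prec> k \<and> (\<forall>y. Q i m y))"
    using hyp by (simp add: upd)
qed

lemma bounding_imp_models_BSigma2:
  assumes bounding
  shows "M \<Turnstile> BSigma2"
  unfolding models_def
proof (intro conjI ballI allI impI sets_nonempty)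
  fix \<chi> e and E :: "nat \<Rightarrow> 'a set"
  assume "\<chi> \<in> BSigma2" and E: "\<forall>X. E X \<in> sets"
  then obtain i n m k \<phi> where \<chi>: "\<chi> = ((\<^bold>\<forall> i \<^bold>< Var n. \<^bold>\<exists> m. \<phi>) \<^bold>\<longrightarrow>
      (\<^bold>\<exists> k. \<^bold>\<forall> i \<^bold>< Var n. \<^bold>\<exists> m \<^bold>< Var k. \<phi>))"
    and \<phi>: "is_Sigma2 \<phi>" and dist: "distinct [i, n, m, k]" and k: "k \<notin> fvn \<phi>"
    unfolding BSigma2_def by blast
  from \<phi> obtain x y \<theta> where \<phi>: "\<phi> = (\<^bold>\<exists> x. \<^bold>\<forall> y. \<theta>)" and \<theta>: "bounded_fm \<theta>"
    unfolding is_Sigma2_def is_Pi1_def by blast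
  define Q where "Q a b c d \<longleftrightarrow> sat M (e(i := a, m := b, x := c, y := d)) E \<theta>" for a b c d
  (* A single witness w coding the pair of m and the witness c of the existential quantifier. *)
  define Q' where "Q' a w d \<longleftrightarrow> (\<exists>b. b \<prec> w \<oplus> \<one> \<and> (\<exists>c. c \<prec> w \<oplus> \<one> \<and> w = \<langle>b, c\<rangle> \<and> Q a b c d))" for a w d
  have D: "delta0 M (\<lambda>e'. Q (f e') (g e') (h e') (l e'))"
    if "term_fun M f" "term_fun M g" "term_fun M h" "term_fun M l" for f g h l
  proof -
    (* The order of the cases matters: x and y may coincide with i or m, and then the inner
       quantifier determines the value. *)
    define s where "s j = (if j = y then l else if j = x then h else if j = m then g
      else if j = i then f else (\<lambda>_. e j))" for j
    have "delta0 M (\<lambda>e'. sat M (\<lambda>j. s j e') E \<theta>)"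
      by (rule delta0_subst[OF delta0_sat[OF \<theta>]])
        (use E that in \<open>auto simp: s_def intro: term_fun.const\<close>)
    moreover have "(\<lambda>j. s j e') = e(i := f e', m := g e', x := h e', y := l e')" for e'
      by (auto simp: s_def)
    ultimately show ?thesis by (simp add: Q_def)
  qed
  have D': "delta0 M (\<lambda>e. Q' (e 0) (e 1) (e 2))"
    unfolding Q'_def by (intro definable D)
  have Q'_pr: "Q' a \<langle>b, c\<rangle> d \<longleftrightarrow> Q a b c d" for a b c d
    unfolding Q'_def by (auto simp: less_succ_iff le_pr)
  have shift: "sat M (e(k := K, i := a, m := b)) E \<phi> \<longleftrightarrow> sat M (e(i := a, m := b)) E \<phi>" for K a b
    by (rule sat_cong_fvn) (use k in auto)
  have "sat M (e(i := a, m := b)) E \<phi> \<longleftrightarrow> (\<exists>c. \<forall>d. Q a b c d)" for a b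
    by (simp add: \<phi> Q_def)
  note sat = shift this
  have "\<exists>K. \<forall>a. a \<prec> e n \<longrightarrow> (\<exists>b. b \<prec> K \<and> (\<exists>c. \<forall>d. Q a b c d))"
    if hyp: "\<forall>a. a \<prec> e n \<longrightarrow> (\<exists>b c. \<forall>d. Q a b c d)"
  proof -
    have "\<forall>a. a \<prec> e n \<longrightarrow> (\<exists>w. \<forall>d. Q' a w d)" using hyp Q'_pr by metis
    with assms[unfolded bounding_def, rule_format, OF D', of "e n"]
    obtain K where K: "\<And>a. a \<prec> e n \<Longrightarrow> \<exists>w. w \<prec> K \<and> (\<forall>d. Q' a w d)"
      by auto
    have "\<exists>b. b \<prec> K \<and> (\<exists>c. \<forall>d. Q a b c d)" if a: "a \<prec> e n" for a
    proof -
      obtain w where w: "w \<prec> K" "\<forall>d. Q' a w d" using K[OF a] by blast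
      then obtain b c where bc: "w = \<langle>b, c\<rangle>" unfolding Q'_def by blast
      with w have "\<forall>d. Q a b c d" by (simp add: Q'_pr)
      moreover have "b \<prec> K" using le_pr(1)[of b c] w(1) unfolding bc by order
      ultimately show ?thesis by blast
    qed
    then show ?thesis by blast
  qed
  then show "sat M e E \<chi>"
    using dist by (simp add: \<chi> sat del: fun_upd_apply) auto
qed

section \<open>Orders in a model\<close>

text \<open>
  The meanings of the formulas about orders, for sets \<open>P\<close> and \<open>R\<close> of the model.
\<close>

definition partial_order :: "'a set \<Rightarrow> 'a set \<Rightarrow> bool" where
  "partial_order P R \<longleftrightarrow>
    (\<forall>z \<in> R. \<exists>x \<in> P. \<exists>y \<in> P. z = \<langle>x, y\<rangle>) \<and>
    (\<forall>x \<in> P. \<langle>x, x\<rangle> \<in> R) \<and>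
    (\<forall>x y. \<langle>x, y\<rangle> \<in> R \<and> \<langle>y, x\<rangle> \<in> R \<longrightarrow> x = y) \<and>
    (\<forall>x y z. \<langle>x, y\<rangle> \<in> R \<and> \<langle>y, z\<rangle> \<in> R \<longrightarrow> \<langle>x, z\<rangle> \<in> R)"

definition linear_ext :: "'a set \<Rightarrow> 'a set \<Rightarrow> 'a set \<Rightarrow> bool" where
  "linear_ext P R L \<longleftrightarrow> partial_order P L \<and>
    (\<forall>x y. x \<in> P \<and> y \<in> P \<longrightarrow> \<langle>x, y\<rangle> \<in> L \<or> \<langle>y, x\<rangle> \<in> L) \<and>
    (\<forall>x y. \<langle>x, y\<rangle> \<in> R \<longrightarrow> \<langle>x, y\<rangle> \<in> L)"

definition omega :: "'a set \<Rightarrow> 'a set \<Rightarrow> bool" where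
  "omega P R \<longleftrightarrow> (\<forall>x. x \<in> P \<longrightarrow> (\<exists>m. \<forall>y. y \<in> P \<and> \<langle>y, x\<rangle> \<in> R \<and> y \<noteq> x \<longrightarrow> y \<prec> m))"

definition omega_star :: "'a set \<Rightarrow> 'a set \<Rightarrow> bool" where
  "omega_star P R \<longleftrightarrow> (\<forall>x. x \<in> P \<longrightarrow> (\<exists>m. \<forall>y. y \<in> P \<and> \<langle>x, y\<rangle> \<in> R \<and> x \<noteq> y \<longrightarrow> y \<prec> m))"

definition zeta :: "'a set \<Rightarrow> 'a set \<Rightarrow> bool" where
  "zeta P R \<longleftrightarrow> (\<forall>x y. x \<in> P \<and> y \<in> P \<longrightarrow>
    (\<exists>m. \<forall>z. z \<in> P \<and> (\<langle>x, z\<rangle> \<in> R \<and> x \<noteq> z) \<and> (\<langle>z, y\<rangle> \<in> R \<and> z \<noteq> y) \<longrightarrow> z \<prec> m))"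

definition all_linearizable :: "('a set \<Rightarrow> 'a set \<Rightarrow> bool) \<Rightarrow> bool" where
  "all_linearizable \<tau> \<longleftrightarrow> (\<forall>P \<in> sets. \<forall>R \<in> sets. partial_order P R \<and> \<tau> P R \<longrightarrow>
    (\<exists>L \<in> sets. linear_ext P R L \<and> \<tau> P L))"

lemma eval_pair: "eval_tm M e (pair s t) = \<langle>eval_tm M e s, eval_tm M e t\<rangle>"
  by (simp add: pair_def pr_def)

lemma sat_partial_order_fm: "sat M e E (partial_order_fm P R) \<longleftrightarrow> partial_order (E P) (E R)"
  unfolding partial_order_fm_def partial_order_def Let_def ord_le_def
  by (simp add: eval_pair) blast

lemma sat_linear_extension:
  "sat M e E (linear_extension P R L) \<longleftrightarrow> linear_ext (E P) (E R) (E L)"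
  unfolding linear_extension_def linear_order_fm_def linear_ext_def Let_def sat.simps(5)
    sat_partial_order_fm
  by (simp add: ord_le_def eval_pair)

lemma sat_order_types:
  "sat M e E (omega_like P R) \<longleftrightarrow> omega (E P) (E R)"
  "sat M e E (omega_star_like P R) \<longleftrightarrow> omega_star (E P) (E R)"
  "sat M e E (zeta_like P R) \<longleftrightarrow> zeta (E P) (E R)"
  by (simp_all add: omega_like_def omega_star_like_def zeta_like_def omega_def omega_star_def
      zeta_def Let_def ord_lt_def ord_le_def eval_pair)

lemma models_linearizable:
  assumes "\<And>e E P R. sat M e E (\<tau> P R) \<longleftrightarrow> \<tau>' (E P) (E R)"
  shows "M \<Turnstile> {linearizable \<tau>} \<longleftrightarrow> all_linearizable \<tau>'"
proof -
  have "sat M e E (linearizable \<tau>) \<longleftrightarrow> all_linearizable \<tau>'" for e E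
    unfolding linearizable_def all_linearizable_def Let_def
    by (simp add: assms sat_partial_order_fm sat_linear_extension)
  moreover obtain A where "A \<in> sets" using sets_nonempty by blast
  then have "\<exists>E :: nat \<Rightarrow> 'a set. \<forall>X. E X \<in> sets" by (intro exI[of _ "\<lambda>_. A"]) simp
  ultimately show ?thesis
    unfolding models_def using sets_nonempty by simp
qed

lemma
  assumes "partial_order P R"
  shows partial_order_field: "\<langle>x, y\<rangle> \<in> R \<Longrightarrow> x \<in> P \<and> y \<in> P"
    and partial_order_refl: "x \<in> P \<Longrightarrow> \<langle>x, x\<rangle> \<in> R"
    and partial_order_antisym: "\<langle>x, y\<rangle> \<in> R \<Longrightarrow> \<langle>y, x\<rangle> \<in> R \<Longrightarrow> x = y"
    and partial_order_trans: "\<langle>x, y\<rangle> \<in> R \<Longrightarrow> \<langle>y, z\<rangle> \<in> R \<Longrightarrow> \<langle>x, z\<rangle> \<in> R"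
proof -
  have "z \<in> R \<Longrightarrow> \<exists>x \<in> P. \<exists>y \<in> P. z = \<langle>x, y\<rangle>" for z
    using assms unfolding partial_order_def by blast
  from this[of "\<langle>x, y\<rangle>"] show "\<langle>x, y\<rangle> \<in> R \<Longrightarrow> x \<in> P \<and> y \<in> P" by auto
  show "x \<in> P \<Longrightarrow> \<langle>x, x\<rangle> \<in> R" using assms unfolding partial_order_def by blast
  show "\<langle>x, y\<rangle> \<in> R \<Longrightarrow> \<langle>y, x\<rangle> \<in> R \<Longrightarrow> x = y"
    using assms unfolding partial_order_def by blast
  show "\<langle>x, y\<rangle> \<in> R \<Longrightarrow> \<langle>y, z\<rangle> \<in> R \<Longrightarrow> \<langle>x, z\<rangle> \<in> R"
    using assms unfolding partial_order_def by blast
qed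

text \<open>
  The code of the relation \<open>r\<close> on \<open>P\<close>. The quantifiers are bounded so that the set exists by
  comprehension.
\<close>

definition rel_set :: "'a set \<Rightarrow> ('a \<Rightarrow> 'a \<Rightarrow> bool) \<Rightarrow> 'a set" where
  "rel_set P r = {z. \<exists>x. x \<prec> z \<oplus> \<one> \<and> (\<exists>y. y \<prec> z \<oplus> \<one> \<and> z = \<langle>x, y\<rangle> \<and> x \<in> P \<and> y \<in> P \<and> r x y)}"

lemma pr_mem_rel_set [simp]: "\<langle>x, y\<rangle> \<in> rel_set P r \<longleftrightarrow> x \<in> P \<and> y \<in> P \<and> r x y"
  by (auto simp: rel_set_def less_succ_iff le_pr)

lemma rel_set_sets:
  assumes "P \<in> sets" "delta0 M (\<lambda>e. r (e 0) (e 1))"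
  shows "rel_set P r \<in> sets"
  unfolding rel_set_def
  by (rule comprehension) (intro definable delta0_subst2[OF assms(2)] assms)

lemma partial_order_rel_set:
  assumes "\<And>x. x \<in> P \<Longrightarrow> r x x"
    "\<And>x y. x \<in> P \<Longrightarrow> y \<in> P \<Longrightarrow> r x y \<Longrightarrow> r y x \<Longrightarrow> x = y"
    "\<And>x y z. x \<in> P \<Longrightarrow> y \<in> P \<Longrightarrow> z \<in> P \<Longrightarrow> r x y \<Longrightarrow> r y z \<Longrightarrow> r x z"
  shows "partial_order P (rel_set P r)"
proof -
  have "\<exists>x \<in> P. \<exists>y \<in> P. z = \<langle>x, y\<rangle>" if "z \<in> rel_set P r" for z
    using that by (auto simp: rel_set_def)
  then show ?thesis
    unfolding partial_order_def pr_mem_rel_set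
    by (intro conjI ballI allI impI) (simp_all, (use assms in blast)+)
qed

section \<open>The lexicographic linear extension\<close>

text \<open>
  The lexicographic order on the characteristic functions of the upper cones: at the first place \<open>u\<close>
  where the upper cones of \<open>x\<close> and \<open>z\<close> differ, \<open>u\<close> belongs to that of \<open>x\<close>.
\<close>

definition lex :: "'a set \<Rightarrow> 'a \<Rightarrow> 'a \<Rightarrow> bool" where
  "lex R x z \<longleftrightarrow> (\<exists>u. \<langle>x, u\<rangle> \<in> R \<and> \<langle>z, u\<rangle> \<notin> R \<and> (\<forall>v. v \<prec> u \<longrightarrow> (\<langle>x, v\<rangle> \<in> R \<longleftrightarrow> \<langle>z, v\<rangle> \<in> R)))"

text \<open>
  Distinct elements have distinct upper cones, since each lies in its own cone and by antisymmetry
  not both lie in both.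
\<close>

lemma first_difference:
  assumes R: "R \<in> sets" and po: "partial_order P R" and "x \<in> P" "z \<in> P" "x \<noteq> z"
  obtains u where "\<langle>x, u\<rangle> \<in> R \<longleftrightarrow> \<langle>z, u\<rangle> \<notin> R" "\<And>v. v \<prec> u \<Longrightarrow> \<langle>x, v\<rangle> \<in> R \<longleftrightarrow> \<langle>z, v\<rangle> \<in> R"
proof -
  obtain w where w: "\<not> (\<langle>x, w\<rangle> \<in> R \<longleftrightarrow> \<langle>z, w\<rangle> \<in> R)"
    using assms partial_order_refl[OF po] partial_order_antisym[OF po] by metis
  have "delta0 M (\<lambda>e. \<not> (\<langle>x, e 0\<rangle> \<in> R \<longleftrightarrow> \<langle>z, e 0\<rangle> \<in> R))"
    by (intro definable R)
  from least_number[OF this, OF w] obtain u where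
    "\<not> (\<langle>x, u\<rangle> \<in> R \<longleftrightarrow> \<langle>z, u\<rangle> \<in> R)" "\<And>v. v \<prec> u \<Longrightarrow> \<not> \<not> (\<langle>x, v\<rangle> \<in> R \<longleftrightarrow> \<langle>z, v\<rangle> \<in> R)"
    by blast
  then show thesis by (intro that[of u]) blast+
qed

lemma lex_irrefl: "\<not> lex R x x"
  unfolding lex_def by blast

lemma lex_trans:
  assumes "lex R x y" "lex R y z"
  shows "lex R x z"
proof -
  obtain u where u: "\<langle>x, u\<rangle> \<in> R" "\<langle>y, u\<rangle> \<notin> R" "\<And>v. v \<prec> u \<Longrightarrow> \<langle>x, v\<rangle> \<in> R \<longleftrightarrow> \<langle>y, v\<rangle> \<in> R"
    using assms(1) unfolding lex_def by blast
  obtain w where w: "\<langle>y, w\<rangle> \<in> R" "\<langle>z, w\<rangle> \<notin> R" "\<And>v. v \<prec> w \<Longrightarrow> \<langle>y, v\<rangle> \<in> R \<longleftrightarrow> \<langle>z, v\<rangle> \<in> R"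
    using assms(2) unfolding lex_def by blast
  consider "u \<prec> w" | "u = w" | "w \<prec> u" using less_linear by blast
  then show ?thesis
  proof cases
    case 1
    then have "v \<prec> w" if "v \<prec> u" for v using that by order
    with 1 u w show ?thesis unfolding lex_def by (intro exI[of _ u]) blast
  next
    case 2
    with u w show ?thesis by blast
  next
    case 3
    then have "v \<prec> u" if "v \<prec> w" for v using that by order
    with 3 u w show ?thesis unfolding lex_def by (intro exI[of _ w]) blast
  qed
qed

lemma lex_total:
  assumes "R \<in> sets" "partial_order P R" "x \<in> P" "z \<in> P" "x \<noteq> z"
  shows "lex R x z \<or> lex R z x"
proof -
  obtain u where "\<langle>x, u\<rangle> \<in> R \<longleftrightarrow> \<langle>z, u\<rangle> \<notin> R" "\<And>v. v \<prec> u \<Longrightarrow> \<langle>x, v\<rangle> \<in> R \<longleftrightarrow> \<langle>z, v\<rangle> \<in> R"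
    using first_difference[OF assms] by blast
  then show ?thesis unfolding lex_def by blast
qed

text \<open>
  If \<open>x\<close> is below \<open>z\<close>, the upper cone of \<open>x\<close> contains that of \<open>z\<close>, so any difference is in favour
  of \<open>x\<close>.
\<close>

lemma lex_extends:
  assumes "R \<in> sets" "partial_order P R" "\<langle>x, z\<rangle> \<in> R" "x \<noteq> z"
  shows "lex R x z"
proof -
  have "x \<in> P" "z \<in> P" using partial_order_field[OF assms(2,3)] by auto
  then obtain u where "\<langle>x, u\<rangle> \<in> R \<longleftrightarrow> \<langle>z, u\<rangle> \<notin> R" "\<And>v. v \<prec> u \<Longrightarrow> \<langle>x, v\<rangle> \<in> R \<longleftrightarrow> \<langle>z, v\<rangle> \<in> R"
    using first_difference[OF assms(1,2) _ _ assms(4)] by blast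
  moreover have "\<langle>z, u\<rangle> \<in> R \<Longrightarrow> \<langle>x, u\<rangle> \<in> R" using partial_order_trans[OF assms(2,3)] .
  ultimately show ?thesis unfolding lex_def by blast
qed

text \<open>
  The first difference occurs no later than at \<open>x\<close> or at \<open>z\<close>: agreement at both places would put
  \<open>x\<close> below \<open>z\<close> and \<open>z\<close> below \<open>x\<close>. So the order is defined by a bounded formula.
\<close>

lemma lex_bounded:
  assumes "R \<in> sets" "partial_order P R" "x \<in> P" "z \<in> P"
  shows "lex R x z \<longleftrightarrow> (\<exists>u. u \<prec> x \<oplus> z \<oplus> \<one> \<and> \<langle>x, u\<rangle> \<in> R \<and> \<langle>z, u\<rangle> \<notin> R \<and>
    (\<forall>v. v \<prec> u \<longrightarrow> (\<langle>x, v\<rangle> \<in> R \<longleftrightarrow> \<langle>z, v\<rangle> \<in> R)))"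
proof
  assume "lex R x z"
  then obtain u where u: "\<langle>x, u\<rangle> \<in> R" "\<langle>z, u\<rangle> \<notin> R" "\<And>v. v \<prec> u \<Longrightarrow> \<langle>x, v\<rangle> \<in> R \<longleftrightarrow> \<langle>z, v\<rangle> \<in> R"
    unfolding lex_def by blast
  have "u \<preceq> x \<or> u \<preceq> z"
  proof (rule ccontr)
    assume "\<not> ?thesis"
    then have "x \<prec> u" "z \<prec> u" by auto
    then have "\<langle>z, x\<rangle> \<in> R" "\<langle>x, z\<rangle> \<in> R"
      using u(3)[of x] u(3)[of z] partial_order_refl[OF assms(2)] assms(3,4) by auto
    then have "x = z" by (rule partial_order_antisym[OF assms(2), rotated])
    then show False using u(1,2) by simp
  qed
  then have "u \<preceq> x \<oplus> z" using le_add(1)[of x z] le_add(2)[of z x] by (auto intro: ord.order_trans)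
  with u show "\<exists>u. u \<prec> x \<oplus> z \<oplus> \<one> \<and> \<langle>x, u\<rangle> \<in> R \<and> \<langle>z, u\<rangle> \<notin> R \<and>
      (\<forall>v. v \<prec> u \<longrightarrow> (\<langle>x, v\<rangle> \<in> R \<longleftrightarrow> \<langle>z, v\<rangle> \<in> R))"
    by (intro exI[of _ u]) (simp add: less_succ_iff)
next
  assume "\<exists>u. u \<prec> x \<oplus> z \<oplus> \<one> \<and> \<langle>x, u\<rangle> \<in> R \<and> \<langle>z, u\<rangle> \<notin> R \<and>
      (\<forall>v. v \<prec> u \<longrightarrow> (\<langle>x, v\<rangle> \<in> R \<longleftrightarrow> \<langle>z, v\<rangle> \<in> R))"
  then show "lex R x z" unfolding lex_def by (elim exE conjE) (intro exI conjI)
qed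

lemma lex_linear_ext:
  assumes R: "R \<in> sets" and P: "P \<in> sets" and po: "partial_order P R"
  obtains L where "L \<in> sets" "linear_ext P R L"
    "\<And>x z. \<langle>z, x\<rangle> \<in> L \<longleftrightarrow> z \<in> P \<and> x \<in> P \<and> (z = x \<or> lex R z x)"
proof -
  let ?r = "\<lambda>x z. x = z \<or> lex R x z"
  let ?b = "\<lambda>x z. x = z \<or> (\<exists>u. u \<prec> x \<oplus> z \<oplus> \<one> \<and> \<langle>x, u\<rangle> \<in> R \<and> \<langle>z, u\<rangle> \<notin> R \<and>
    (\<forall>v. v \<prec> u \<longrightarrow> (\<langle>x, v\<rangle> \<in> R \<longleftrightarrow> \<langle>z, v\<rangle> \<in> R)))"
  have "rel_set P ?b \<in> sets"
    by (rule rel_set_sets[OF P]) (intro definable R)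
  moreover have "rel_set P ?b = rel_set P ?r"
    unfolding rel_set_def using lex_bounded[OF R po] by blast
  ultimately have "rel_set P ?r \<in> sets" by simp
  moreover have "partial_order P (rel_set P ?r)"
    by (rule partial_order_rel_set) (use lex_trans lex_irrefl in blast)+
  then have "linear_ext P R (rel_set P ?r)"
    unfolding linear_ext_def
    using lex_total[OF R po] lex_extends[OF R po] partial_order_field[OF po] by auto
  ultimately show thesis by (rule that) simp
qed

text \<open>
  If \<open>z\<close> precedes \<open>x\<close> lexicographically, then \<open>z\<close> is below some \<open>y \<preceq> x\<close> in \<open>R\<close>: the first difference
  \<open>u\<close> if \<open>u \<preceq> x\<close>, and otherwise \<open>x\<close> itself, where the cones still agree. Bounding applied to the
  finitely many finite lower cones of these \<open>y\<close> gives the bound.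
\<close>

theorem bounding_imp_omega_linear_ext:
  assumes B: bounding and R: "R \<in> sets" and P: "P \<in> sets" and po: "partial_order P R"
    and om: "omega P R"
  shows "\<exists>L \<in> sets. linear_ext P R L \<and> omega P L"
proof -
  obtain L where L: "L \<in> sets" "linear_ext P R L"
    and L_iff: "\<And>x z. \<langle>z, x\<rangle> \<in> L \<longleftrightarrow> z \<in> P \<and> x \<in> P \<and> (z = x \<or> lex R z x)"
    by (rule lex_linear_ext[OF R P po], rule that)
  have "\<exists>m. \<forall>z. \<langle>z, y\<rangle> \<in> R \<longrightarrow> z \<prec> m" for y
  proof (cases "y \<in> P")
    case True
    then obtain m where m: "\<And>z. z \<in> P \<Longrightarrow> \<langle>z, y\<rangle> \<in> R \<Longrightarrow> z \<noteq> y \<Longrightarrow> z \<prec> m"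
      using om unfolding omega_def by blast
    have "z \<prec> m \<oplus> y \<oplus> \<one>" if "\<langle>z, y\<rangle> \<in> R" for z
    proof (cases "z = y")
      case True
      then show ?thesis by (simp add: less_succ_iff le_add)
    next
      case False
      then have "z \<prec> m" using m partial_order_field[OF po that] that by blast
      moreover have "m \<preceq> m \<oplus> y" by (rule le_add)
      ultimately show ?thesis unfolding less_succ_iff by order
    qed
    then show ?thesis by blast
  next
    case False
    then show ?thesis using partial_order_field[OF po] by blast
  qed
  note bnd = this
  have "\<exists>m. \<forall>z. z \<in> P \<and> \<langle>z, x\<rangle> \<in> L \<and> z \<noteq> x \<longrightarrow> z \<prec> m" if x: "x \<in> P" for x
  proof -
    have "delta0 M (\<lambda>e. \<langle>e 2, e 0\<rangle> \<in> R \<longrightarrow> e 2 \<prec> e 1)" by (intro definable R)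
    from B[unfolded bounding_def, rule_format, of "\<lambda>y m z. \<langle>z, y\<rangle> \<in> R \<longrightarrow> z \<prec> m", OF this, of "x \<oplus> \<one>"] bnd
    obtain k where k: "\<And>y. y \<prec> x \<oplus> \<one> \<Longrightarrow> \<exists>m. m \<prec> k \<and> (\<forall>z. \<langle>z, y\<rangle> \<in> R \<longrightarrow> z \<prec> m)"
      by auto
    have "z \<prec> k" if "\<langle>z, x\<rangle> \<in> L" "z \<noteq> x" for z
    proof -
      from that have "lex R z x" using L_iff by blast
      then obtain u where u: "\<langle>z, u\<rangle> \<in> R" "\<And>v. v \<prec> u \<Longrightarrow> \<langle>z, v\<rangle> \<in> R \<longleftrightarrow> \<langle>x, v\<rangle> \<in> R"
        unfolding lex_def by blast
      have "\<exists>y. y \<preceq> x \<and> \<langle>z, y\<rangle> \<in> R"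
      proof (cases "u \<preceq> x")
        case False
        then have "x \<prec> u" by order
        then have "\<langle>z, x\<rangle> \<in> R" using u(2) partial_order_refl[OF po x] by blast
        then show ?thesis by blast
      qed (use u in blast)
      then obtain y where "y \<prec> x \<oplus> \<one>" "\<langle>z, y\<rangle> \<in> R" by (auto simp: less_succ_iff)
      with k obtain m where "m \<prec> k" "z \<prec> m" by blast
      then show ?thesis by order
    qed
    then show ?thesis by blast
  qed
  then have "omega P L" unfolding omega_def by blast
  with L show ?thesis by blast
qed

section \<open>Reversing orders\<close>

definition reverse :: "'a set \<Rightarrow> 'a set \<Rightarrow> 'a set" where
  "reverse P R = rel_set P (\<lambda>x y. \<langle>y, x\<rangle> \<in> R)"

lemma pr_mem_reverse [simp]: "\<langle>x, y\<rangle> \<in> reverse P R \<longleftrightarrow> x \<in> P \<and> y \<in> P \<and> \<langle>y, x\<rangle> \<in> R"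
  by (simp add: reverse_def)

lemma reverse_sets: "P \<in> sets \<Longrightarrow> R \<in> sets \<Longrightarrow> reverse P R \<in> sets"
  unfolding reverse_def by (rule rel_set_sets) (simp, intro definable)

lemma partial_order_reverse: "partial_order P R \<Longrightarrow> partial_order P (reverse P R)"
  unfolding reverse_def
  by (rule partial_order_rel_set)
    (blast intro: partial_order_refl partial_order_antisym partial_order_trans)+

lemma omega_reverse: "omega P (reverse P R) \<longleftrightarrow> omega_star P R"
  unfolding omega_def omega_star_def pr_mem_reverse by metis

lemma omega_star_reverse: "omega_star P (reverse P R) \<longleftrightarrow> omega P R"
  unfolding omega_def omega_star_def pr_mem_reverse by metis

lemma linear_ext_reverse:
  assumes po: "partial_order P R" and L: "linear_ext P (reverse P R) L"
  shows "linear_ext P R (reverse P L)"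
  unfolding linear_ext_def
proof (intro conjI allI impI)
  show "partial_order P (reverse P L)"
    using L unfolding linear_ext_def by (intro partial_order_reverse) blast
  show "\<langle>x, y\<rangle> \<in> reverse P L \<or> \<langle>y, x\<rangle> \<in> reverse P L" if "x \<in> P \<and> y \<in> P" for x y
    using L that unfolding linear_ext_def by auto
  show "\<langle>x, y\<rangle> \<in> reverse P L" if "\<langle>x, y\<rangle> \<in> R" for x y
    using L that partial_order_field[OF po that] unfolding linear_ext_def by auto
qed

text \<open>
  Used for \<open>\<omega>\<close> and \<open>\<omega>\<^sup>*\<close>, which are exchanged by reversal.
\<close>

lemma all_linearizable_reverse:
  assumes lin: "all_linearizable \<tau>"
    and rev: "\<And>P R. \<tau> P (reverse P R) \<longleftrightarrow> \<sigma> P R" "\<And>P R. \<sigma> P (reverse P R) \<longleftrightarrow> \<tau> P R"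
  shows "all_linearizable \<sigma>"
  unfolding all_linearizable_def
proof (intro ballI impI)
  fix P R assume P: "P \<in> sets" and R: "R \<in> sets" and po: "partial_order P R \<and> \<sigma> P R"
  have "\<exists>L \<in> sets. linear_ext P (reverse P R) L \<and> \<tau> P L"
    using lin[unfolded all_linearizable_def] P reverse_sets[OF P R] partial_order_reverse po rev(1)
    by blast
  then obtain L where L: "L \<in> sets" "linear_ext P (reverse P R) L" "\<tau> P L" by blast
  show "\<exists>L \<in> sets. linear_ext P R L \<and> \<sigma> P L"
  proof (intro bexI conjI)
    show "reverse P L \<in> sets" by (rule reverse_sets[OF P L(1)])
    show "linear_ext P R (reverse P L)" using po L by (intro linear_ext_reverse) auto
    show "\<sigma> P (reverse P L)" using rev(2) L(3) by blast
  qed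
qed

lemma omega_star_linearizable_iff: "all_linearizable omega_star \<longleftrightarrow> all_linearizable omega"
proof
  show "all_linearizable omega" if "all_linearizable omega_star"
    by (rule all_linearizable_reverse[OF that]) (rule omega_star_reverse omega_reverse)+
  show "all_linearizable omega_star" if "all_linearizable omega"
    by (rule all_linearizable_reverse[OF that]) (rule omega_star_reverse omega_reverse)+
qed

lemma bounding_imp_omega_linearizable: "bounding \<Longrightarrow> all_linearizable omega"
  unfolding all_linearizable_def using bounding_imp_omega_linear_ext by blast


section \<open>Orders with finite intervals\<close>

lemma zeta_interval_bounded:
  assumes po: "partial_order P R" and z: "zeta P R"
  shows "\<exists>m. \<forall>z. \<langle>x, z\<rangle> \<in> R \<and> \<langle>z, y\<rangle> \<in> R \<longrightarrow> z \<prec> m"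
proof (cases "x \<in> P \<and> y \<in> P")
  case True
  then obtain m where m: "\<And>z. z \<in> P \<Longrightarrow> \<langle>x, z\<rangle> \<in> R \<Longrightarrow> x \<noteq> z \<Longrightarrow> \<langle>z, y\<rangle> \<in> R \<Longrightarrow> z \<noteq> y \<Longrightarrow> z \<prec> m"
    using z unfolding zeta_def by meson
  have "z \<preceq> x \<oplus> y \<oplus> m" if "\<langle>x, z\<rangle> \<in> R" "\<langle>z, y\<rangle> \<in> R" for z
  proof -
    have "z \<preceq> x \<or> z \<preceq> y \<or> z \<preceq> m"
      using m[of z] that partial_order_field[OF po] by (auto simp: ord.le_less)
    moreover have "x \<preceq> x \<oplus> y" "y \<preceq> x \<oplus> y" "x \<oplus> y \<preceq> x \<oplus> y \<oplus> m" "m \<preceq> x \<oplus> y \<oplus> m"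
      by (rule le_add)+
    ultimately show ?thesis by (meson ord.order_trans)
  qed
  then show ?thesis by (intro exI[of _ "x \<oplus> y \<oplus> m \<oplus> \<one>"]) (simp add: less_succ_iff)
next
  case False
  then show ?thesis using partial_order_field[OF po] by blast
qed

text \<open>
  As for lower cones in the \<open>\<omega>\<close>-like case, bounding unites the finite intervals between \<open>x\<close> and the
  finitely many \<open>y \<preceq> x\<close>.
\<close>

lemma zeta_intervals_bounded:
  assumes B: bounding and po: "partial_order P R" and R: "R \<in> sets" and z: "zeta P R"
  shows "\<exists>k. \<forall>y z. y \<preceq> x \<and> \<langle>y, z\<rangle> \<in> R \<and> \<langle>z, x\<rangle> \<in> R \<longrightarrow> z \<prec> k" (is ?A)
    and "\<exists>k. \<forall>y z. y \<preceq> x \<and> \<langle>x, z\<rangle> \<in> R \<and> \<langle>z, y\<rangle> \<in> R \<longrightarrow> z \<prec> k" (is ?B)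
proof -
  have "delta0 M (\<lambda>e. \<langle>e 0, e 2\<rangle> \<in> R \<and> \<langle>e 2, x\<rangle> \<in> R \<longrightarrow> e 2 \<prec> e 1)"
    by (intro definable R)
  from B[unfolded bounding_def, rule_format, of "\<lambda>y m z. \<langle>y, z\<rangle> \<in> R \<and> \<langle>z, x\<rangle> \<in> R \<longrightarrow> z \<prec> m",
      OF this, of "x \<oplus> \<one>"] zeta_interval_bounded[OF po z]
  obtain k where k: "\<And>y. y \<prec> x \<oplus> \<one> \<Longrightarrow> \<exists>m. m \<prec> k \<and> (\<forall>z. \<langle>y, z\<rangle> \<in> R \<and> \<langle>z, x\<rangle> \<in> R \<longrightarrow> z \<prec> m)"
    by blast
  show ?A
  proof (intro exI[of _ k] allI impI)
    fix y z assume *: "y \<preceq> x \<and> \<langle>y, z\<rangle> \<in> R \<and> \<langle>z, x\<rangle> \<in> R"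
    then obtain m where "m \<prec> k" "z \<prec> m" using k[of y] by (auto simp: less_succ_iff)
    then show "z \<prec> k" by order
  qed
  have "delta0 M (\<lambda>e. \<langle>x, e 2\<rangle> \<in> R \<and> \<langle>e 2, e 0\<rangle> \<in> R \<longrightarrow> e 2 \<prec> e 1)"
    by (intro definable R)
  from B[unfolded bounding_def, rule_format, of "\<lambda>y m z. \<langle>x, z\<rangle> \<in> R \<and> \<langle>z, y\<rangle> \<in> R \<longrightarrow> z \<prec> m",
      OF this, of "x \<oplus> \<one>"] zeta_interval_bounded[OF po z]
  obtain k where k: "\<And>y. y \<prec> x \<oplus> \<one> \<Longrightarrow> \<exists>m. m \<prec> k \<and> (\<forall>z. \<langle>x, z\<rangle> \<in> R \<and> \<langle>z, y\<rangle> \<in> R \<longrightarrow> z \<prec> m)"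
    by blast
  show ?B
  proof (intro exI[of _ k] allI impI)
    fix y z assume *: "y \<preceq> x \<and> \<langle>x, z\<rangle> \<in> R \<and> \<langle>z, y\<rangle> \<in> R"
    then obtain m where "m \<prec> k" "z \<prec> m" using k[of y] by (auto simp: less_succ_iff)
    then show "z \<prec> k" by order
  qed
qed

text \<open>
  Let \<open>y\<close> be the numerically least element comparable with \<open>z\<close>; then \<open>z\<close> is put into \<open>U\<close> or \<open>D\<close>
  according to the side of \<open>y\<close> on which it lies, \<open>z = y\<close> being put into \<open>U\<close>. If \<open>z\<close> is a predecessor of
  \<open>x\<close> in \<open>U\<close>, then \<open>y \<preceq> x\<close> as numbers, because \<open>x\<close> is comparable with \<open>z\<close>. So \<open>z\<close> lies in the
  interval from \<open>y\<close> to \<open>x\<close>, one of finitely many finite intervals. The argument for \<open>D\<close> is dual.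
\<close>

lemma zeta_split:
  assumes B: bounding and P: "P \<in> sets" and R: "R \<in> sets" and po: "partial_order P R" and z: "zeta P R"
  obtains U D where "U \<in> sets" "D \<in> sets" "U \<union> D = P" "U \<inter> D = {}"
    "\<And>x y. x \<in> U \<Longrightarrow> \<langle>x, y\<rangle> \<in> R \<Longrightarrow> y \<in> U"
    "omega U (rel_set U (\<lambda>x y. \<langle>x, y\<rangle> \<in> R))" "omega_star D (rel_set D (\<lambda>x y. \<langle>x, y\<rangle> \<in> R))"
proof -
  define comp where "comp x y \<longleftrightarrow> \<langle>x, y\<rangle> \<in> R \<or> \<langle>y, x\<rangle> \<in> R" for x y
  define U where "U = {x. x \<in> P \<and> (\<exists>y. y \<prec> x \<oplus> \<one> \<and> \<langle>y, x\<rangle> \<in> R \<and> (\<forall>v. v \<prec> y \<longrightarrow> \<not> comp v x))}"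
  define D where "D = {x. x \<in> P \<and> x \<notin> U}"
  have U: "U \<in> sets"
    unfolding U_def comp_def by (rule comprehension) (intro definable P R)
  have D: "D \<in> sets"
    unfolding D_def by (rule comprehension) (intro definable P U)
  have UD: "U \<union> D = P" "U \<inter> D = {}" unfolding D_def U_def by auto
  have up: "\<exists>y. \<langle>y, x\<rangle> \<in> R \<and> (\<forall>v. comp v x \<longrightarrow> y \<preceq> v)" if "x \<in> U" for x
    using that unfolding U_def by (auto simp: ord.not_less[symmetric])
  have down: "\<exists>y. \<langle>x, y\<rangle> \<in> R \<and> \<langle>y, x\<rangle> \<notin> R \<and> (\<forall>v. comp v x \<longrightarrow> y \<preceq> v)" if "x \<in> D" for x
  proof -
    have x: "x \<in> P" "x \<notin> U" using that unfolding D_def by auto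
    have "comp x x" using partial_order_refl[OF po x(1)] by (simp add: comp_def)
    moreover have "delta0 M (\<lambda>e. comp (e 0) x)" unfolding comp_def by (intro definable R)
    ultimately obtain y where y: "comp y x" "\<And>v. v \<prec> y \<Longrightarrow> \<not> comp v x"
      using least_number[of "\<lambda>y. comp y x" x] by blast
    then have "y \<preceq> x" using \<open>comp x x\<close> by (auto simp: ord.not_less[symmetric])
    then have "\<langle>y, x\<rangle> \<notin> R" using x y(2) unfolding U_def by (auto simp: less_succ_iff)
    with y show ?thesis by (auto simp: comp_def ord.not_less[symmetric])
  qed
  have closed: "y \<in> U" if x: "x \<in> U" and xy: "\<langle>x, y\<rangle> \<in> R" for x y
  proof (rule ccontr)
    (* Otherwise u, x, y, w is an ascending chain, where u and w are the least elements comparable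
       with x and y. Both are comparable with x and y, so they coincide and the chain collapses. *)
    assume "y \<notin> U"
    then have "y \<in> D" using partial_order_field[OF po xy] UD by auto
    then obtain w where w: "\<langle>y, w\<rangle> \<in> R" "\<langle>w, y\<rangle> \<notin> R" "\<And>v. comp v y \<Longrightarrow> w \<preceq> v" using down by blast
    obtain u where u: "\<langle>u, x\<rangle> \<in> R" "\<And>v. comp v x \<Longrightarrow> u \<preceq> v" using up x by blast
    have uy: "\<langle>u, y\<rangle> \<in> R" by (rule partial_order_trans[OF po u(1) xy])
    have "\<langle>x, w\<rangle> \<in> R" by (rule partial_order_trans[OF po xy w(1)])
    then have "u \<preceq> w" "w \<preceq> u" using u(2)[of w] w(3)[of u] uy by (auto simp: comp_def)
    then have "u = w" by order
    with uy w(2) show False by simp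
  qed
  have om: "omega U (rel_set U (\<lambda>x y. \<langle>x, y\<rangle> \<in> R))"
    unfolding omega_def
  proof (intro allI impI)
    fix x assume "x \<in> U"
    obtain k where k: "\<And>y z. y \<preceq> x \<Longrightarrow> \<langle>y, z\<rangle> \<in> R \<Longrightarrow> \<langle>z, x\<rangle> \<in> R \<Longrightarrow> z \<prec> k"
      using zeta_intervals_bounded(1)[OF B po R z] by blast
    have "z \<prec> k" if "z \<in> U" "\<langle>z, x\<rangle> \<in> R" for z
    proof -
      obtain y where "\<langle>y, z\<rangle> \<in> R" "\<And>v. comp v z \<Longrightarrow> y \<preceq> v" using up \<open>z \<in> U\<close> by blast
      then show ?thesis using k[of y z] that(2) by (auto simp: comp_def)
    qed
    then show "\<exists>m. \<forall>y. y \<in> U \<and> \<langle>y, x\<rangle> \<in> rel_set U (\<lambda>x y. \<langle>x, y\<rangle> \<in> R) \<and> y \<noteq> x \<longrightarrow> y \<prec> m"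
      by (intro exI[of _ k]) auto
  qed
  have om': "omega_star D (rel_set D (\<lambda>x y. \<langle>x, y\<rangle> \<in> R))"
    unfolding omega_star_def
  proof (intro allI impI)
    fix x assume "x \<in> D"
    obtain k where k: "\<And>y z. y \<preceq> x \<Longrightarrow> \<langle>x, z\<rangle> \<in> R \<Longrightarrow> \<langle>z, y\<rangle> \<in> R \<Longrightarrow> z \<prec> k"
      using zeta_intervals_bounded(2)[OF B po R z] by blast
    have "z \<prec> k" if "z \<in> D" "\<langle>x, z\<rangle> \<in> R" for z
    proof -
      obtain y where "\<langle>z, y\<rangle> \<in> R" "\<And>v. comp v z \<Longrightarrow> y \<preceq> v" using down \<open>z \<in> D\<close> by blast
      then show ?thesis using k[of y z] that(2) by (auto simp: comp_def)
    qed
    then show "\<exists>m. \<forall>y. y \<in> D \<and> \<langle>x, y\<rangle> \<in> rel_set D (\<lambda>x y. \<langle>x, y\<rangle> \<in> R) \<and> x \<noteq> y \<longrightarrow> y \<prec> m"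
      by (intro exI[of _ k]) auto
  qed
  show thesis by (rule that[OF U D UD closed om om'])
qed

lemma
  assumes "linear_ext P R L"
  shows linear_ext_partial_order: "partial_order P L"
    and linear_ext_total: "x \<in> P \<Longrightarrow> y \<in> P \<Longrightarrow> \<langle>x, y\<rangle> \<in> L \<or> \<langle>y, x\<rangle> \<in> L"
    and linear_ext_extends: "\<langle>x, y\<rangle> \<in> R \<Longrightarrow> \<langle>x, y\<rangle> \<in> L"
  using assms unfolding linear_ext_def by auto

text \<open>
  A linear extension of \<open>D\<close> of type \<open>\<omega>\<^sup>*\<close> is followed by one of \<open>U\<close> of type \<open>\<omega>\<close>. The elements of \<open>U\<close> in an
  interval precede its right end, those of \<open>D\<close> succeed its left end.
\<close>

theorem bounding_imp_zeta_linearizable: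
  assumes B: bounding
  shows "all_linearizable zeta"
  unfolding all_linearizable_def
proof (intro ballI impI, elim conjE)
  fix P R assume P: "P \<in> sets" and R: "R \<in> sets" and po: "partial_order P R" and z: "zeta P R"
  obtain U D where U: "U \<in> sets" and D: "D \<in> sets" and UD: "U \<union> D = P" "U \<inter> D = {}"
    and closed: "\<And>x y. x \<in> U \<Longrightarrow> \<langle>x, y\<rangle> \<in> R \<Longrightarrow> y \<in> U"
    and om: "omega U (rel_set U (\<lambda>x y. \<langle>x, y\<rangle> \<in> R))" "omega_star D (rel_set D (\<lambda>x y. \<langle>x, y\<rangle> \<in> R))"
    by (rule zeta_split[OF B P R po z], rule that)
  have restrict: "rel_set A (\<lambda>x y. \<langle>x, y\<rangle> \<in> R) \<in> sets" "partial_order A (rel_set A (\<lambda>x y. \<langle>x, y\<rangle> \<in> R))"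
    if "A \<in> sets" "A \<subseteq> P" for A
  proof -
    show "rel_set A (\<lambda>x y. \<langle>x, y\<rangle> \<in> R) \<in> sets"
      by (rule rel_set_sets[OF that(1)]) (intro definable R)
    show "partial_order A (rel_set A (\<lambda>x y. \<langle>x, y\<rangle> \<in> R))"
    proof (rule partial_order_rel_set)
      show "\<langle>x, x\<rangle> \<in> R" if "x \<in> A" for x using that \<open>A \<subseteq> P\<close> partial_order_refl[OF po] by blast
      show "x = y" if "\<langle>x, y\<rangle> \<in> R" "\<langle>y, x\<rangle> \<in> R" for x y by (rule partial_order_antisym[OF po that])
      show "\<langle>x, z\<rangle> \<in> R" if "\<langle>x, y\<rangle> \<in> R" "\<langle>y, z\<rangle> \<in> R" for x y z by (rule partial_order_trans[OF po that])
    qed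
  qed
  have sub: "U \<subseteq> P" "D \<subseteq> P" using UD by auto
  obtain LU where LU: "LU \<in> sets" "linear_ext U (rel_set U (\<lambda>x y. \<langle>x, y\<rangle> \<in> R)) LU" "omega U LU"
    using bounding_imp_omega_linearizable[OF B] restrict[OF U sub(1)] U om(1)
    unfolding all_linearizable_def by blast
  obtain LD where LD: "LD \<in> sets" "linear_ext D (rel_set D (\<lambda>x y. \<langle>x, y\<rangle> \<in> R)) LD" "omega_star D LD"
    using bounding_imp_omega_linearizable[OF B, folded omega_star_linearizable_iff]
      restrict[OF D sub(2)] D om(2)
    unfolding all_linearizable_def by blast
  define r where "r x y \<longleftrightarrow> \<langle>x, y\<rangle> \<in> LU \<or> \<langle>x, y\<rangle> \<in> LD \<or> x \<in> D \<and> y \<in> U" for x y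
  define L where "L = rel_set P r"
  have L: "L \<in> sets"
    unfolding L_def r_def by (rule rel_set_sets[OF P]) (intro definable LU LD U D)
  have poU: "partial_order U LU" and poD: "partial_order D LD"
    using linear_ext_partial_order LU(2) LD(2) by auto
  have fU: "x \<in> U \<and> y \<in> U \<and> x \<notin> D \<and> y \<notin> D" if "\<langle>x, y\<rangle> \<in> LU" for x y
    using partial_order_field[OF poU that] UD by auto
  have fD: "x \<in> D \<and> y \<in> D \<and> x \<notin> U \<and> y \<notin> U" if "\<langle>x, y\<rangle> \<in> LD" for x y
    using partial_order_field[OF poD that] UD by auto
  have disj: "x \<notin> D" if "x \<in> U" for x using that UD by auto
  have poL: "partial_order P L"
    unfolding L_def
  proof (rule partial_order_rel_set)
    show "r x x" if "x \<in> P" for x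
      using that UD partial_order_refl[OF poU] partial_order_refl[OF poD] unfolding r_def by blast
    show "x = y" if "r x y" "r y x" for x y
      using that partial_order_antisym[OF poU, of x y] partial_order_antisym[OF poD, of x y]
      unfolding r_def by (auto dest: fU fD disj)
    show "r x z" if "r x y" "r y z" for x y z
      using that partial_order_trans[OF poU, of x y z] partial_order_trans[OF poD, of x y z]
      unfolding r_def by (auto dest: fU fD disj)
  qed
  have lin: "linear_ext P R L"
    unfolding linear_ext_def
  proof (intro conjI allI impI poL)
    show "\<langle>x, y\<rangle> \<in> L \<or> \<langle>y, x\<rangle> \<in> L" if "x \<in> P \<and> y \<in> P" for x y
      using that linear_ext_total[OF LU(2), of x y] linear_ext_total[OF LD(2), of x y] UD
      unfolding L_def r_def by auto
    show "\<langle>x, y\<rangle> \<in> L" if xy: "\<langle>x, y\<rangle> \<in> R" for x y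
      using partial_order_field[OF po xy] closed[OF _ xy] UD xy
        linear_ext_extends[OF LU(2), of x y] linear_ext_extends[OF LD(2), of x y]
      unfolding L_def r_def by auto
  qed
  have "zeta P L"
    unfolding zeta_def
  proof (intro allI impI)
    fix x y assume xy: "x \<in> P \<and> y \<in> P"
    have "\<exists>m. \<forall>z. z \<in> U \<and> \<langle>z, y\<rangle> \<in> L \<and> z \<noteq> y \<longrightarrow> z \<prec> m"
    proof (cases "y \<in> U")
      case True
      then obtain m where "\<And>z. z \<in> U \<Longrightarrow> \<langle>z, y\<rangle> \<in> LU \<Longrightarrow> z \<noteq> y \<Longrightarrow> z \<prec> m"
        using LU(3) unfolding omega_def by blast
      then show ?thesis using UD by (intro exI[of _ m]) (auto simp: L_def r_def dest: fD)
    next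
      case False
      then have "\<langle>z, y\<rangle> \<notin> L" if "z \<in> U" for z
        using that by (auto simp: L_def r_def dest: fU fD disj)
      then show ?thesis by blast
    qed
    then obtain m where m: "\<And>z. z \<in> U \<Longrightarrow> \<langle>z, y\<rangle> \<in> L \<Longrightarrow> z \<noteq> y \<Longrightarrow> z \<prec> m" by blast
    have "\<exists>m. \<forall>z. z \<in> D \<and> \<langle>x, z\<rangle> \<in> L \<and> x \<noteq> z \<longrightarrow> z \<prec> m"
    proof (cases "x \<in> D")
      case True
      then obtain m where "\<And>z. z \<in> D \<Longrightarrow> \<langle>x, z\<rangle> \<in> LD \<Longrightarrow> x \<noteq> z \<Longrightarrow> z \<prec> m"
        using LD(3) unfolding omega_star_def by blast
      then show ?thesis using UD by (intro exI[of _ m]) (auto simp: L_def r_def dest: fU)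
    next
      case False
      then have "\<langle>x, z\<rangle> \<notin> L" if "z \<in> D" for z
        using that by (auto simp: L_def r_def dest: fU fD disj)
      then show ?thesis by blast
    qed
    then obtain m' where m': "\<And>z. z \<in> D \<Longrightarrow> \<langle>x, z\<rangle> \<in> L \<Longrightarrow> x \<noteq> z \<Longrightarrow> z \<prec> m'" by blast
    have "z \<prec> m \<oplus> m'" if "z \<in> P" "\<langle>x, z\<rangle> \<in> L" "x \<noteq> z" "\<langle>z, y\<rangle> \<in> L" "z \<noteq> y" for z
    proof -
      have "z \<prec> m \<or> z \<prec> m'" using that UD m[of z] m'[of z] by blast
      moreover have "m \<preceq> m \<oplus> m'" "m' \<preceq> m \<oplus> m'" by (rule le_add)+
      ultimately show ?thesis by (auto intro: ord.less_le_trans)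
    qed
    then show "\<exists>m. \<forall>z. z \<in> P \<and> (\<langle>x, z\<rangle> \<in> L \<and> x \<noteq> z) \<and> (\<langle>z, y\<rangle> \<in> L \<and> z \<noteq> y) \<longrightarrow> z \<prec> m"
      by blast
  qed
  with L lin show "\<exists>L \<in> sets. linear_ext P R L \<and> zeta P L" by blast
qed

section \<open>From linearizability to bounding\<close>

lemma omega_imp_zeta: "omega P R \<Longrightarrow> zeta P R"
  unfolding omega_def zeta_def by meson

lemma succ_neq_zero [simp]: "i \<oplus> \<one> \<noteq> \<zero>" "\<zero> \<noteq> i \<oplus> \<one>"
proof -
  have "\<zero> \<prec> i \<oplus> \<one>" by (simp add: less_succ_iff zero_le)
  then show "i \<oplus> \<one> \<noteq> \<zero>" "\<zero> \<noteq> i \<oplus> \<one>" by auto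
qed

lemma succ_inject [simp]: "i \<oplus> \<one> = j \<oplus> \<one> \<longleftrightarrow> i = j"
  using add_cancel[of \<one> i j] by (auto simp: add_comm)

text \<open>
  The order used for the reverse implications: the bottom is \<open>\<langle>0, 0\<rangle>\<close>, the tops are \<open>\<langle>0, i + 1\<rangle>\<close>,
  and \<open>\<langle>i + 1, w\<rangle>\<close> with \<open>w\<close> in \<open>X\<^sub>i\<close> lies between the bottom and the \<open>i\<close>-th top. The bottom element is
  there for the \<open>\<zeta>\<close> case: without it all intervals would be trivial and a \<open>\<zeta>\<close>-like extension would not
  bound anything.
\<close>

lemma omega_fan:
  assumes X: "delta0 M (\<lambda>e. X (e 0) (e 1))"
    and bnd: "\<And>i. i \<prec> n \<Longrightarrow> \<exists>m. \<forall>w. X i w \<longrightarrow> w \<prec> m"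
  obtains P R where "P \<in> sets" "R \<in> sets" "partial_order P R" "omega P R"
    "\<And>i. i \<prec> n \<Longrightarrow> \<langle>\<zero>, i \<oplus> \<one>\<rangle> \<in> P"
    "\<And>i w. i \<prec> n \<Longrightarrow> X i w \<Longrightarrow>
      \<langle>\<langle>\<zero>, \<zero>\<rangle>, \<langle>i \<oplus> \<one>, w\<rangle>\<rangle> \<in> R \<and> \<langle>\<langle>i \<oplus> \<one>, w\<rangle>, \<langle>\<zero>, i \<oplus> \<one>\<rangle>\<rangle> \<in> R"
proof -
  define P where "P = {v. v = \<langle>\<zero>, \<zero>\<rangle> \<or> (\<exists>i. i \<prec> n \<and> v = \<langle>\<zero>, i \<oplus> \<one>\<rangle>) \<or>
    (\<exists>i. i \<prec> n \<and> (\<exists>w. w \<prec> v \<oplus> \<one> \<and> v = \<langle>i \<oplus> \<one>, w\<rangle> \<and> X i w))}"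
  define r where "r a b \<longleftrightarrow> a = b \<or> a = \<langle>\<zero>, \<zero>\<rangle> \<or>
    (\<exists>i. i \<prec> n \<and> (\<exists>w. w \<prec> a \<oplus> \<one> \<and> a = \<langle>i \<oplus> \<one>, w\<rangle> \<and> b = \<langle>\<zero>, i \<oplus> \<one>\<rangle>))" for a b
  have P: "P \<in> sets"
    unfolding P_def by (rule comprehension) (intro definable delta0_subst2[OF X])
  have R: "rel_set P r \<in> sets"
    unfolding r_def by (rule rel_set_sets[OF P]) (intro definable)
  have r_iff: "r a b \<longleftrightarrow> a = b \<or> a = \<langle>\<zero>, \<zero>\<rangle> \<or> (\<exists>i w. i \<prec> n \<and> a = \<langle>i \<oplus> \<one>, w\<rangle> \<and> b = \<langle>\<zero>, i \<oplus> \<one>\<rangle>)" for a b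
    unfolding r_def by (auto simp: less_succ_iff le_pr)
  have P_iff: "v \<in> P \<longleftrightarrow> v = \<langle>\<zero>, \<zero>\<rangle> \<or> (\<exists>i. i \<prec> n \<and> v = \<langle>\<zero>, i \<oplus> \<one>\<rangle>) \<or>
      (\<exists>i w. i \<prec> n \<and> v = \<langle>i \<oplus> \<one>, w\<rangle> \<and> X i w)" for v
    unfolding P_def by (auto simp: less_succ_iff le_pr)
  have po: "partial_order P (rel_set P r)"
    by (rule partial_order_rel_set) (auto simp: r_iff)
  have om: "omega P (rel_set P r)"
    unfolding omega_def
  proof (intro allI impI)
    fix b assume "b \<in> P"
    show "\<exists>m. \<forall>a. a \<in> P \<and> \<langle>a, b\<rangle> \<in> rel_set P r \<and> a \<noteq> b \<longrightarrow> a \<prec> m"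
    proof (cases "\<exists>i. i \<prec> n \<and> b = \<langle>\<zero>, i \<oplus> \<one>\<rangle>")
      case True
      then obtain i where i: "i \<prec> n" "b = \<langle>\<zero>, i \<oplus> \<one>\<rangle>" by blast
      obtain m where m: "\<And>w. X i w \<Longrightarrow> w \<prec> m" using bnd[OF i(1)] by blast
      have "a \<preceq> \<langle>i \<oplus> \<one>, m\<rangle>" if "a \<in> P" "\<langle>a, b\<rangle> \<in> rel_set P r" "a \<noteq> b" for a
      proof -
        from that consider "a = \<langle>\<zero>, \<zero>\<rangle>" | w where "a = \<langle>i \<oplus> \<one>, w\<rangle>" "X i w"
          by (auto simp: r_iff i(2) P_iff)
        then show ?thesis
        proof cases
          case 1
          then show ?thesis by (simp add: pr_mono zero_le del: ord.not_less)
        next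
          case 2
          then have "w \<preceq> m" using m[OF 2(2)] by order
          then show ?thesis unfolding 2 by (rule pr_mono[OF ord.order_refl])
        qed
      qed
      then show ?thesis by (intro exI[of _ "\<langle>i \<oplus> \<one>, m\<rangle> \<oplus> \<one>"]) (simp add: less_succ_iff)
    next
      case False
      then have "a = \<langle>\<zero>, \<zero>\<rangle>" if "\<langle>a, b\<rangle> \<in> rel_set P r" "a \<noteq> b" for a
        using that by (auto simp: r_iff)
      then show ?thesis by (intro exI[of _ "\<langle>\<zero>, \<zero>\<rangle> \<oplus> \<one>"]) (auto simp: less_succ_iff)
    qed
  qed
  show thesis
  proof (rule that[OF P R po om])
    show "\<langle>\<zero>, i \<oplus> \<one>\<rangle> \<in> P" if "i \<prec> n" for i
      using that by (auto simp: P_iff)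
    show "\<langle>\<langle>\<zero>, \<zero>\<rangle>, \<langle>i \<oplus> \<one>, w\<rangle>\<rangle> \<in> rel_set P r \<and>
        \<langle>\<langle>i \<oplus> \<one>, w\<rangle>, \<langle>\<zero>, i \<oplus> \<one>\<rangle>\<rangle> \<in> rel_set P r" if "i \<prec> n" "X i w" for i w
      using that by (auto simp: r_iff P_iff)
  qed
qed

text \<open>
  By induction on \<open>k\<close>, one of the \<open>n\<close> elements is above all of the first \<open>k\<close>. This is a
  bounded statement, so \<open>\<Sigma>\<^sup>0\<^sub>1\<close> induction suffices.
\<close>

lemma largest_in_linear_order:
  assumes L: "L \<in> sets" and lin: "linear_ext P R L"
    and t: "\<And>i. i \<prec> n \<Longrightarrow> \<langle>c, i \<oplus> \<one>\<rangle> \<in> P" and n: "\<zero> \<prec> n"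
  shows "\<exists>j. j \<prec> n \<and> (\<forall>i. i \<prec> n \<longrightarrow> \<langle>\<langle>c, i \<oplus> \<one>\<rangle>, \<langle>c, j \<oplus> \<one>\<rangle>\<rangle> \<in> L)"
proof -
  let ?Q = "\<lambda>k. \<exists>j. j \<prec> n \<and> (\<forall>i. i \<prec> k \<longrightarrow> i \<prec> n \<longrightarrow> \<langle>\<langle>c, i \<oplus> \<one>\<rangle>, \<langle>c, j \<oplus> \<one>\<rangle>\<rangle> \<in> L)"
  have "?Q n"
  proof (rule delta0_induct[of ?Q])
    show "delta0 M (\<lambda>e. ?Q (e 0))" by (intro definable L)
    show "?Q \<zero>" using n not_less_zero by blast
    fix k assume "?Q k"
    then obtain j where j: "j \<prec> n" "\<And>i. i \<prec> k \<Longrightarrow> i \<prec> n \<Longrightarrow> \<langle>\<langle>c, i \<oplus> \<one>\<rangle>, \<langle>c, j \<oplus> \<one>\<rangle>\<rangle> \<in> L"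
      by blast
    note trans = partial_order_trans[OF linear_ext_partial_order[OF lin]]
    show "?Q (k \<oplus> \<one>)"
    proof (cases "k \<prec> n \<and> \<langle>\<langle>c, k \<oplus> \<one>\<rangle>, \<langle>c, j \<oplus> \<one>\<rangle>\<rangle> \<notin> L")
      case True
      then have jk: "\<langle>\<langle>c, j \<oplus> \<one>\<rangle>, \<langle>c, k \<oplus> \<one>\<rangle>\<rangle> \<in> L"
        using linear_ext_total[OF lin t t, of j k] j(1) by blast
      have kk: "\<langle>\<langle>c, k \<oplus> \<one>\<rangle>, \<langle>c, k \<oplus> \<one>\<rangle>\<rangle> \<in> L"
        using linear_ext_total[OF lin t t, of k k] True by blast
      have "\<langle>\<langle>c, i \<oplus> \<one>\<rangle>, \<langle>c, k \<oplus> \<one>\<rangle>\<rangle> \<in> L" if "i \<preceq> k" "i \<prec> n" for i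
        using that kk trans[OF j(2) jk] by (cases "i = k") (auto simp: ord.le_less)
      with True show ?thesis by (auto simp: less_succ_iff)
    next
      case False
      then have "\<langle>\<langle>c, i \<oplus> \<one>\<rangle>, \<langle>c, j \<oplus> \<one>\<rangle>\<rangle> \<in> L" if "i \<preceq> k" "i \<prec> n" for i
        using that j(2) by (cases "i = k") (auto simp: ord.le_less)
      with j(1) show ?thesis by (auto simp: less_succ_iff)
    qed
  qed
  then show ?thesis by blast
qed

text \<open>
  The hypothesis on linear extensions follows from the linearizability of \<open>\<omega>\<close> as well as from that
  of \<open>\<zeta>\<close>, so one argument serves both.
\<close>

lemma finite_union_bounded:
  assumes lin: "\<And>P R. P \<in> sets \<Longrightarrow> R \<in> sets \<Longrightarrow> partial_order P R \<Longrightarrow> omega P R \<Longrightarrow>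
      \<exists>L \<in> sets. linear_ext P R L \<and> zeta P L"
    and X: "delta0 M (\<lambda>e. X (e 0) (e 1))"
    and bnd: "\<And>i. i \<prec> n \<Longrightarrow> \<exists>m. \<forall>w. X i w \<longrightarrow> w \<prec> m"
  shows "\<exists>b. \<forall>i w. i \<prec> n \<and> X i w \<longrightarrow> w \<prec> b"
proof (cases "n = \<zero>")
  case True
  then show ?thesis using not_less_zero by blast
next
  case False
  then have n: "\<zero> \<prec> n" using zero_least[of n] by auto
  obtain P R where PR: "P \<in> sets" "R \<in> sets" "partial_order P R" "omega P R"
    and t: "\<And>i. i \<prec> n \<Longrightarrow> \<langle>\<zero>, i \<oplus> \<one>\<rangle> \<in> P"
    and x: "\<And>i w. i \<prec> n \<Longrightarrow> X i w \<Longrightarrow>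
      \<langle>\<langle>\<zero>, \<zero>\<rangle>, \<langle>i \<oplus> \<one>, w\<rangle>\<rangle> \<in> R \<and> \<langle>\<langle>i \<oplus> \<one>, w\<rangle>, \<langle>\<zero>, i \<oplus> \<one>\<rangle>\<rangle> \<in> R"
    by (rule omega_fan[OF X bnd], assumption, rule that)
  obtain L where L: "L \<in> sets" "linear_ext P R L" "zeta P L" using lin[OF PR] by blast
  obtain j where j: "j \<prec> n" "\<And>i. i \<prec> n \<Longrightarrow> \<langle>\<langle>\<zero>, i \<oplus> \<one>\<rangle>, \<langle>\<zero>, j \<oplus> \<one>\<rangle>\<rangle> \<in> L"
    using largest_in_linear_order[OF L(1,2) t n] by blast
  have poL: "partial_order P L" by (rule linear_ext_partial_order[OF L(2)])
  obtain m where m: "\<And>v. \<langle>\<langle>\<zero>, \<zero>\<rangle>, v\<rangle> \<in> L \<Longrightarrow> \<langle>v, \<langle>\<zero>, j \<oplus> \<one>\<rangle>\<rangle> \<in> L \<Longrightarrow> v \<prec> m"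
    using zeta_interval_bounded[OF poL L(3)] by blast
  have "w \<prec> m" if "i \<prec> n" "X i w" for i w
  proof -
    have "\<langle>i \<oplus> \<one>, w\<rangle> \<prec> m"
      using m x[OF that] linear_ext_extends[OF L(2)] partial_order_trans[OF poL _ j(2)[OF that(1)]] by blast
    moreover have "w \<preceq> \<langle>i \<oplus> \<one>, w\<rangle>" by (rule le_pr)
    ultimately show ?thesis by order
  qed
  then show ?thesis by blast
qed

text \<open>
  \<open>G i m y\<close> says that at stage \<open>y\<close> all candidates \<open>l \<preceq> m\<close> have been refuted, and \<open>X i\<close> collects the pairs
  of \<open>m\<close> and the first such stage. \<open>X i\<close> is bounded, since \<open>G i m y\<close> fails for any true witness \<open>m\<close>; by
  \<open>\<Sigma>\<^sup>0\<^sub>1\<close> induction there is a last \<open>m\<close> for which a stage exists, and its stage dominates the earlier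
  ones. If \<open>b\<close> bounds all the sets \<open>X i\<close>, then some \<open>m \<preceq> b\<close> is a witness for \<open>i\<close>: otherwise all of them
  are refuted, by \<open>\<Sigma>\<^sup>0\<^sub>1\<close> induction at a common stage, and \<open>X i\<close> contains a pair with first
  component \<open>b\<close>.
\<close>

lemma linearizable_imp_bounding:
  assumes lin: "\<And>P R. P \<in> sets \<Longrightarrow> R \<in> sets \<Longrightarrow> partial_order P R \<Longrightarrow> omega P R \<Longrightarrow>
      \<exists>L \<in> sets. linear_ext P R L \<and> zeta P L"
  shows bounding
  unfolding bounding_def
proof (intro allI impI)
  fix Q n
  assume Q: "delta0 M (\<lambda>e. Q (e 0) (e 1) (e 2))"
    and hyp: "\<forall>i. i \<prec> n \<longrightarrow> (\<exists>m. \<forall>y. Q i m y)"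
  define G where "G i m y \<longleftrightarrow> (\<forall>l. l \<prec> m \<oplus> \<one> \<longrightarrow> (\<exists>z. z \<prec> y \<oplus> \<one> \<and> \<not> Q i l z))" for i m y
  define X where "X i w \<longleftrightarrow> (\<exists>m. m \<prec> w \<oplus> \<one> \<and> (\<exists>y. y \<prec> w \<oplus> \<one> \<and> w = \<langle>m, y\<rangle> \<and>
      G i m y \<and> (\<forall>z. z \<prec> y \<longrightarrow> \<not> G i m z)))" for i w
  have DG: "delta0 M (\<lambda>e. G (f e) (g e) (h e))"
    if "term_fun M f" "term_fun M g" "term_fun M h" for f g h
  proof (rule delta0_subst3[OF _ that])
    show "delta0 M (\<lambda>e. G (e 0) (e 1) (e 2))"
      unfolding G_def by (intro definable delta0_subst3[OF Q])
  qed
  have DX: "delta0 M (\<lambda>e. X (e 0) (e 1))"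
    unfolding X_def by (intro definable DG)
  have X_pr: "X i \<langle>m, y\<rangle> \<longleftrightarrow> G i m y \<and> (\<forall>z. z \<prec> y \<longrightarrow> \<not> G i m z)" for i m y
    unfolding X_def by (auto simp: less_succ_iff le_pr)
  have G_mono: "G i l y'" if G: "G i m y" and "l \<preceq> m" "y \<preceq> y'" for i l m y y'
    unfolding G_def
  proof (intro allI impI)
    fix l' assume "l' \<prec> l \<oplus> \<one>"
    then have "l' \<preceq> m" using that(2) unfolding less_succ_iff by order
    then obtain z where "z \<preceq> y" "\<not> Q i l' z" using G unfolding G_def less_succ_iff by blast
    then show "\<exists>z. z \<prec> y' \<oplus> \<one> \<and> \<not> Q i l' z"
      using that(3) unfolding less_succ_iff by (intro exI[of _ z]) (auto intro: ord.order_trans)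
  qed
  have G_least: "\<exists>y. X i \<langle>m, y\<rangle>" if "G i m y" for i m y
  proof -
    have "delta0 M (\<lambda>e. G i m (e 0))" by (intro DG definable)
    from least_number[OF this that] show ?thesis unfolding X_pr by blast
  qed
  have X_bounded: "\<exists>b. \<forall>w. X i w \<longrightarrow> w \<prec> b" if i: "i \<prec> n" for i
  proof (cases "\<exists>y. G i \<zero> y")
    case False
    then have "\<not> X i w" for w unfolding X_def using G_mono zero_le ord.order_refl by blast
    then show ?thesis by blast
  next
    case True
    obtain m0 where m0: "\<And>y. Q i m0 y" using hyp i by blast
    then have no: "\<not> G i m0 y" for y unfolding G_def less_succ_iff by blast
    have "\<exists>m. (\<exists>y. G i m y) \<and> \<not> (\<exists>y. G i (m \<oplus> \<one>) y)"
    proof (rule ccontr)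
      assume contr: "\<not> ?thesis"
      have "\<exists>y. G i m0 y"
      proof (rule sigma1_induct[of "G i"])
        show "delta0 M (\<lambda>e. G i (e 0) (e 1))" by (intro DG definable)
        show "\<exists>y. G i \<zero> y" by (rule True)
        show "\<exists>y. G i (m \<oplus> \<one>) y" if "\<exists>y. G i m y" for m using contr that by blast
      qed
      with no show False by blast
    qed
    then obtain m y where m: "G i m y" "\<And>y. \<not> G i (m \<oplus> \<one>) y" by blast
    have "w \<preceq> \<langle>m, y\<rangle>" if "X i w" for w
    proof -
      from that obtain l z where w: "w = \<langle>l, z\<rangle>" and Xlz: "X i \<langle>l, z\<rangle>" unfolding X_def by blast
      then have G: "G i l z" "\<And>v. v \<prec> z \<Longrightarrow> \<not> G i l v" unfolding X_pr by blast+
      have l: "l \<preceq> m"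
      proof (rule ccontr)
        assume "\<not> l \<preceq> m"
        then have "m \<oplus> \<one> \<preceq> l" using less_succ_iff[of l m] by (simp add: ord.not_less)
        then show False using m(2) G_mono[OF G(1) _ ord.order_refl] by blast
      qed
      have "z \<preceq> y"
      proof (rule ccontr)
        assume "\<not> z \<preceq> y"
        then have "y \<prec> z" by order
        with G(2) G_mono[OF m(1) l ord.order_refl] show False by blast
      qed
      with l show ?thesis unfolding w by (rule pr_mono)
    qed
    then show ?thesis by (intro exI[of _ "\<langle>m, y\<rangle> \<oplus> \<one>"]) (simp add: less_succ_iff)
  qed
  obtain b where b: "\<And>i w. i \<prec> n \<Longrightarrow> X i w \<Longrightarrow> w \<prec> b"
    using finite_union_bounded[OF lin DX X_bounded] by blast
  have "\<exists>m. m \<prec> b \<oplus> \<one> \<and> (\<forall>y. Q i m y)" if i: "i \<prec> n" for i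
  proof (rule ccontr)
    assume contr: "\<not> ?thesis"
    have "\<exists>y. k \<preceq> b \<longrightarrow> G i k y" for k
    proof (rule sigma1_induct[of "\<lambda>k y. k \<preceq> b \<longrightarrow> G i k y"])
      show "delta0 M (\<lambda>e. e 0 \<preceq> b \<longrightarrow> G i (e 0) (e 1))" by (intro definable DG)
      have "\<zero> \<prec> b \<oplus> \<one>" by (simp add: less_succ_iff zero_le)
      then obtain y where "\<not> Q i \<zero> y" using contr by blast
      moreover have "l = \<zero>" if "l \<preceq> \<zero>" for l using that zero_le[of l] by order
      ultimately have "G i \<zero> y" unfolding G_def less_succ_iff by blast
      then show "\<exists>y. \<zero> \<preceq> b \<longrightarrow> G i \<zero> y" by blast
      fix k assume IH: "\<exists>y. k \<preceq> b \<longrightarrow> G i k y"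
      show "\<exists>y. k \<oplus> \<one> \<preceq> b \<longrightarrow> G i (k \<oplus> \<one>) y"
      proof (cases "k \<oplus> \<one> \<preceq> b")
        case True
        then obtain y where y: "\<not> Q i (k \<oplus> \<one>) y" using contr by (auto simp: less_succ_iff)
        have "k \<preceq> k \<oplus> \<one>" by (rule le_add)
        then have "k \<preceq> b" using True by order
        with IH obtain z where z: "G i k z" by blast
        have yz: "y \<preceq> y \<oplus> z" "z \<preceq> y \<oplus> z" by (rule le_add)+
        have "G i (k \<oplus> \<one>) (y \<oplus> z)"
          unfolding G_def
        proof (intro allI impI)
          fix l assume "l \<prec> k \<oplus> \<one> \<oplus> \<one>"
          then consider "l = k \<oplus> \<one>" | "l \<prec> k \<oplus> \<one>" by (auto simp: less_succ_iff[of l "k \<oplus> \<one>"] ord.le_less)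
          then show "\<exists>x. x \<prec> y \<oplus> z \<oplus> \<one> \<and> \<not> Q i l x"
          proof cases
            case 1
            with y yz show ?thesis by (auto simp: less_succ_iff)
          next
            case 2
            have "G i k (y \<oplus> z)" by (rule G_mono[OF z ord.order_refl yz(2)])
            with 2 show ?thesis unfolding G_def by blast
          qed
        qed
        then show ?thesis by blast
      qed blast
    qed
    from this[of b] obtain y where "X i \<langle>b, y\<rangle>" using G_least ord.order_refl by blast
    with b[OF i] have "\<langle>b, y\<rangle> \<prec> b" by blast
    moreover have "b \<preceq> \<langle>b, y\<rangle>" by (rule le_pr)
    ultimately show False by order
  qed
  then show "\<exists>k. \<forall>i. i \<prec> n \<longrightarrow> (\<exists>m. m \<prec> k \<and> (\<forall>y. Q i m y))" by blast
qed

theorem BSigma2_iff_linearizable: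
  "M \<Turnstile> BSigma2 \<longleftrightarrow> M \<Turnstile> {linearizable omega_like}"
  "M \<Turnstile> BSigma2 \<longleftrightarrow> M \<Turnstile> {linearizable omega_star_like}"
  "M \<Turnstile> BSigma2 \<longleftrightarrow> M \<Turnstile> {linearizable zeta_like}"
proof -
  have B: "M \<Turnstile> BSigma2 \<longleftrightarrow> bounding"
    using models_BSigma2_imp_bounding bounding_imp_models_BSigma2 by blast
  have "all_linearizable omega \<Longrightarrow> bounding"
    by (rule linearizable_imp_bounding) (unfold all_linearizable_def, blast dest: omega_imp_zeta)
  then have om: "bounding \<longleftrightarrow> all_linearizable omega"
    using bounding_imp_omega_linearizable by blast
  have "all_linearizable zeta \<Longrightarrow> bounding"
    by (rule linearizable_imp_bounding) (unfold all_linearizable_def, blast dest: omega_imp_zeta)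
  then have ze: "bounding \<longleftrightarrow> all_linearizable zeta"
    using bounding_imp_zeta_linearizable by blast
  show "M \<Turnstile> BSigma2 \<longleftrightarrow> M \<Turnstile> {linearizable omega_like}"
    unfolding B om by (rule models_linearizable[of omega_like omega, OF sat_order_types(1), symmetric])
  show "M \<Turnstile> BSigma2 \<longleftrightarrow> M \<Turnstile> {linearizable omega_star_like}"
    unfolding B om omega_star_linearizable_iff[symmetric]
    by (rule models_linearizable[of omega_star_like omega_star, OF sat_order_types(2), symmetric])
  show "M \<Turnstile> BSigma2 \<longleftrightarrow> M \<Turnstile> {linearizable zeta_like}"
    unfolding B ze by (rule models_linearizable[of zeta_like zeta, OF sat_order_types(3), symmetric])
qed

end

theorem theorem3p3:
  fixes M :: "'a l2_structure"
  assumes "M \<Turnstile> RCA0"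
  shows "\<forall>T \<in> {BSigma2, {linearizable omega_like}, {linearizable omega_star_like},
                 {linearizable zeta_like}}.
         \<forall>U \<in> {BSigma2, {linearizable omega_like}, {linearizable omega_star_like},
                 {linearizable zeta_like}}.
         M \<Turnstile> T \<longleftrightarrow> M \<Turnstile> U"
proof -
  interpret rca0_model M by unfold_locales (rule assms)
  show ?thesis using BSigma2_iff_linearizable by simp
qed

end
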